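(* Let $\mathcal M$ be a three-dimensional almost paracosymplectic, non-paracosymplectic $(\kappa,\mu)$-space with structure $(\phi,\xi,\eta,g)$, and let $p$ be a point of $\mathcal M$. Assume there is a local vector field $X$, defined on a neighborhood of $p$, such that $\phi X=X$ and $hX\neq0$ on this neighborhood. Then on a neighborhood of $p$ there are a local Artin frame $(\xi,E_1,E_2)$, a function $b$ and a constant $\epsilon=\pm1$ such that $$\nabla_\xi\xi=0,\quad \nabla_\xi E_1=-\tfrac{\mu}{2}E_1,\quad \nabla_\xi E_2=\tfrac{\mu}{2}E_2,$$ $$\nabla_{E_1}\xi=-\epsilon E_2,\quad \nabla_{E_1}E_1=bE_1+\epsilon\xi,\quad \nabla_{E_1}E_2=-bE_2,$$ $$\nabla_{E_2}\xi=\epsilon\kappa E_1,\quad \nabla_{E_2}E_1=0,\quad \nabla_{E_2}E_2=-\epsilon\kappa\xi.$$ If $\kappa\neq0$, the function $b$ vanishes.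
   Context: All manifolds, tensor fields and functions are smooth; manifolds are connected and without boundary. An almost paracontact metric structure on a $3$-dimensional manifold is a quadruple $(\phi,\xi,\eta,g)$: a $(1,1)$-tensor field $\phi$, a vector field $\xi$, a $1$-form $\eta$ and a pseudo-Riemannian metric $g$ of signature $(2,1)$ with $\phi^2=Id-\eta\otimes\xi$, $\eta(\xi)=1$, $g(\phi X,\phi Y)=-g(X,Y)+\eta(X)\eta(Y)$. The fundamental form is $\Phi(X,Y)=g(X,\phi Y)$. The structure is almost paracosymplectic if $d\eta=0$ and $d\Phi=0$. It is normal if $N_\phi-2\,d\eta\otimes\xi=0$, where $N_\phi(X,Y)=\phi^2[X,Y]+[\phi X,\phi Y]-\phi([\phi X,Y]+[X,\phi Y])$; paracosymplectic means almost paracosymplectic and normal. Put $h=\frac12\mathcal L_\xi\phi$. Let $\nabla$ be the Levi-Civita connection of $g$ and $R_{XY}Z=[\nabla_X,\nabla_Y]Z-\nabla_{[X,Y]}Z$. The manifold is a $(\kappa,\mu)$-space, $\kappa,\mu\in\mathbb R$, if $R_{XY}\xi=\kappa(\eta(Y)X-\eta(X)Y)+\mu(\eta(Y)hX-\eta(X)hY)$ for all $X,Y$. A local Artin frame is a local frame $(\xi,E_1,E_2)$ with $\phi E_1=E_1$, $\phi E_2=-E_2$, $g(\xi,E_1)=g(\xi,E_2)=0$, $g(E_1,E_2)=1$ (then $g(E_1,E_1)=g(E_2,E_2)=0$). *)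

theory Defs
  imports "HOL-Analysis.Analysis" "HOL-Library.Function_Algebras"
begin

(* Tangent vectors will be real-valued functions (derivations), so functions get the
   pointwise vector space structure; span and independent then apply to tangent vectors. *)
instantiation "fun" :: (type, real_vector) real_vector
begin

definition scaleR_fun :: "real \<Rightarrow> ('a \<Rightarrow> 'b) \<Rightarrow> 'a \<Rightarrow> 'b" where
  "scaleR_fun a f = (\<lambda>x. a *\<^sub>R f x)"

instance
  by standard
    (simp_all add: scaleR_fun_def fun_eq_iff scaleR_add_left scaleR_add_right)

end


section \<open>Smooth three-dimensional manifolds\<close>

fun Ck_on :: "nat \<Rightarrow> 'a::euclidean_space set \<Rightarrow> ('a \<Rightarrow> 'b::real_normed_vector) \<Rightarrow> bool" where
  "Ck_on 0 S f \<longleftrightarrow> continuous_on S f"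
| "Ck_on (Suc k) S f \<longleftrightarrow> (\<forall>x\<in>S. f differentiable (at x)) \<and>
      (\<forall>v. Ck_on k S (\<lambda>x. frechet_derivative f (at x) v))"

(* used for open S only *)
definition Cinf_on :: "'a::euclidean_space set \<Rightarrow> ('a \<Rightarrow> 'b::real_normed_vector) \<Rightarrow> bool" where
  "Cinf_on S f \<longleftrightarrow> (\<forall>k. Ck_on k S f)"

(* A chart is a domain together with a coordinate map; only the values of the
   coordinate map on the domain matter. *)
type_synonym 'm chart = "'m set \<times> ('m \<Rightarrow> real^3)"

definition is_chart :: "'m::topological_space chart \<Rightarrow> bool" where
  "is_chart = (\<lambda>(V, c). open V \<and> open (c ` V) \<and> homeomorphism V (c ` V) c (inv_into V c))"

(* The manifold is the whole type 'm; the Hausdorff property and second countability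
   are sort constraints. *)
definition manifold3 :: "'m::{t2_space, second_countable_topology} chart set \<Rightarrow> bool" where
  "manifold3 A \<longleftrightarrow>
     connected (UNIV :: 'm set) \<and>
     (\<forall>C\<in>A. is_chart C) \<and>
     (\<Union>(V, c)\<in>A. V) = UNIV \<and>
     (\<forall>(V, c)\<in>A. \<forall>(W, d)\<in>A. Cinf_on (c ` (V \<inter> W)) (d \<circ> inv_into V c))"

definition smooth_fun :: "'m::topological_space chart set \<Rightarrow> 'm set \<Rightarrow> ('m \<Rightarrow> real) \<Rightarrow> bool" where
  "smooth_fun A U f \<longleftrightarrow> (\<forall>(V, c)\<in>A. Cinf_on (c ` (U \<inter> V)) (f \<circ> inv_into V c))"

definition smooth_at :: "'m::topological_space chart set \<Rightarrow> 'm \<Rightarrow> ('m \<Rightarrow> real) \<Rightarrow> bool" where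
  "smooth_at A p f \<longleftrightarrow> (\<exists>U. open U \<and> p \<in> U \<and> smooth_fun A U f)"


section \<open>Vector fields and tensor fields\<close>

type_synonym 'm tangent = "('m \<Rightarrow> real) \<Rightarrow> real"
type_synonym 'm field = "'m \<Rightarrow> 'm tangent"

(* Derivations at p of the functions that are smooth near p. Locality (the value depends
   only on the germ) is a consequence of the Leibniz rule, because the functions are
   unconstrained away from p. The last clause only makes the representation unique, so that
   equality of tangent vectors is equality of derivations. *)
definition tangent_space :: "'m::topological_space chart set \<Rightarrow> 'm \<Rightarrow> 'm tangent set" where
  "tangent_space A p = {v.
     (\<forall>f g. smooth_at A p f \<and> smooth_at A p g \<longrightarrow>
        v (\<lambda>q. f q + g q) = v f + v g \<and>
        v (\<lambda>q. f q * g q) = f p * v g + g p * v f) \<and>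
     (\<forall>a f. smooth_at A p f \<longrightarrow> v (\<lambda>q. a * f q) = a * v f) \<and>
     (\<forall>f. \<not> smooth_at A p f \<longrightarrow> v f = 0)}"

definition vector_field :: "'m::topological_space chart set \<Rightarrow> 'm set \<Rightarrow> 'm field \<Rightarrow> bool" where
  "vector_field A U X \<longleftrightarrow>
     (\<forall>p\<in>U. X p \<in> tangent_space A p) \<and>
     (\<forall>W f. open W \<and> W \<subseteq> U \<and> smooth_fun A W f \<longrightarrow> smooth_fun A W (\<lambda>p. X p f))"

definition fmult :: "('m \<Rightarrow> real) \<Rightarrow> 'm field \<Rightarrow> 'm field" where
  "fmult f X = (\<lambda>p. f p *\<^sub>R X p)"

definition lie_bracket :: "'m::topological_space chart set \<Rightarrow> 'm field \<Rightarrow> 'm field \<Rightarrow> 'm field" where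
  "lie_bracket A X Y = (\<lambda>p f. if smooth_at A p f
      then X p (\<lambda>q. Y q f) - Y p (\<lambda>q. X q f) else 0)"

definition linear_between :: "'a::real_vector set \<Rightarrow> ('a \<Rightarrow> 'b::real_vector) \<Rightarrow> bool" where
  "linear_between T f \<longleftrightarrow>
     (\<forall>u\<in>T. \<forall>v\<in>T. f (u + v) = f u + f v) \<and> (\<forall>a. \<forall>u\<in>T. f (a *\<^sub>R u) = a *\<^sub>R f u)"

definition one_form ::
  "'m::topological_space chart set \<Rightarrow> ('m \<Rightarrow> 'm tangent \<Rightarrow> real) \<Rightarrow> bool" where
  "one_form A \<eta> \<longleftrightarrow>
     (\<forall>p. linear_between (tangent_space A p) (\<eta> p)) \<and>
     (\<forall>U X. open U \<and> vector_field A U X \<longrightarrow> smooth_fun A U (\<lambda>p. \<eta> p (X p)))"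

definition tensor11 ::
  "'m::topological_space chart set \<Rightarrow> ('m \<Rightarrow> 'm tangent \<Rightarrow> 'm tangent) \<Rightarrow> bool" where
  "tensor11 A \<phi> \<longleftrightarrow>
     (\<forall>p. linear_between (tangent_space A p) (\<phi> p) \<and>
          \<phi> p ` tangent_space A p \<subseteq> tangent_space A p) \<and>
     (\<forall>U X. open U \<and> vector_field A U X \<longrightarrow> vector_field A U (\<lambda>p. \<phi> p (X p)))"

definition tensor02 ::
  "'m::topological_space chart set \<Rightarrow> ('m \<Rightarrow> 'm tangent \<Rightarrow> 'm tangent \<Rightarrow> real) \<Rightarrow> bool" where
  "tensor02 A g \<longleftrightarrow>
     (\<forall>p. \<forall>u\<in>tangent_space A p. linear_between (tangent_space A p) (g p u) \<and>
          linear_between (tangent_space A p) (\<lambda>v. g p v u)) \<and>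
     (\<forall>U X Y. open U \<and> vector_field A U X \<and> vector_field A U Y \<longrightarrow>
          smooth_fun A U (\<lambda>p. g p (X p) (Y p)))"

(* Signature (2,1): two plus signs, one minus sign. Nondegeneracy follows from the
   existence of the pseudo-orthonormal basis. *)
definition pseudo_riemannian_21 ::
  "'m::topological_space chart set \<Rightarrow> ('m \<Rightarrow> 'm tangent \<Rightarrow> 'm tangent \<Rightarrow> real) \<Rightarrow> bool" where
  "pseudo_riemannian_21 A g \<longleftrightarrow>
     tensor02 A g \<and>
     (\<forall>p. \<forall>u\<in>tangent_space A p. \<forall>v\<in>tangent_space A p. g p u v = g p v u) \<and>
     (\<forall>p. \<exists>e1 e2 e3. span {e1, e2, e3} = tangent_space A p \<and>
        g p e1 e1 = 1 \<and> g p e2 e2 = 1 \<and> g p e3 e3 = -1 \<and>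
        g p e1 e2 = 0 \<and> g p e1 e3 = 0 \<and> g p e2 e3 = 0)"

(* Normalisation with the factors 1/2 and 1/3; with it, vanishing of N - 2 d\<eta> \<otimes> \<xi> is
   integrability of the induced almost paracomplex structure on M \<times> R. *)
definition ext_deriv1 :: "'m::topological_space chart set \<Rightarrow> ('m \<Rightarrow> 'm tangent \<Rightarrow> real) \<Rightarrow>
    'm field \<Rightarrow> 'm field \<Rightarrow> 'm \<Rightarrow> real" where
  "ext_deriv1 A \<eta> X Y = (\<lambda>p.
     (X p (\<lambda>q. \<eta> q (Y q)) - Y p (\<lambda>q. \<eta> q (X q)) - \<eta> p (lie_bracket A X Y p)) / 2)"

definition ext_deriv2 :: "'m::topological_space chart set \<Rightarrow>
    ('m \<Rightarrow> 'm tangent \<Rightarrow> 'm tangent \<Rightarrow> real) \<Rightarrow>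
    'm field \<Rightarrow> 'm field \<Rightarrow> 'm field \<Rightarrow> 'm \<Rightarrow> real" where
  "ext_deriv2 A \<Phi> X Y Z = (\<lambda>p.
     (X p (\<lambda>q. \<Phi> q (Y q) (Z q)) + Y p (\<lambda>q. \<Phi> q (Z q) (X q)) + Z p (\<lambda>q. \<Phi> q (X q) (Y q))
      - \<Phi> p (lie_bracket A X Y p) (Z p) - \<Phi> p (lie_bracket A Y Z p) (X p)
      - \<Phi> p (lie_bracket A Z X p) (Y p)) / 3)"

definition lie_deriv11 :: "'m::topological_space chart set \<Rightarrow> 'm field \<Rightarrow>
    ('m \<Rightarrow> 'm tangent \<Rightarrow> 'm tangent) \<Rightarrow> 'm field \<Rightarrow> 'm field" where
  "lie_deriv11 A Z \<phi> X = (\<lambda>p.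
     lie_bracket A Z (\<lambda>q. \<phi> q (X q)) p - \<phi> p (lie_bracket A Z X p))"


section \<open>Levi-Civita connection and curvature\<close>

(* A connection is given by its action on local vector fields, D X Y being the covariant
   derivative of Y in the direction X. *)
definition affine_connection ::
  "'m::topological_space chart set \<Rightarrow> ('m field \<Rightarrow> 'm field \<Rightarrow> 'm field) \<Rightarrow> bool" where
  "affine_connection A D \<longleftrightarrow>
     (\<forall>U X X' Y Y' f. open U \<and> vector_field A U X \<and> vector_field A U X' \<and>
        vector_field A U Y \<and> vector_field A U Y' \<and> smooth_fun A U f \<longrightarrow>
        vector_field A U (D X Y) \<and>
        (\<forall>p\<in>U.
           D (X + X') Y p = D X Y p + D X' Y p \<and>
           D (fmult f X) Y p = f p *\<^sub>R D X Y p \<and>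
           D X (Y + Y') p = D X Y p + D X Y' p \<and>
           D X (fmult f Y) p = X p f *\<^sub>R Y p + f p *\<^sub>R D X Y p))"

definition levi_civita :: "'m::topological_space chart set \<Rightarrow>
    ('m \<Rightarrow> 'm tangent \<Rightarrow> 'm tangent \<Rightarrow> real) \<Rightarrow> ('m field \<Rightarrow> 'm field \<Rightarrow> 'm field) \<Rightarrow> bool" where
  "levi_civita A g D \<longleftrightarrow>
     affine_connection A D \<and>
     (\<forall>U X Y Z. open U \<and> vector_field A U X \<and> vector_field A U Y \<and> vector_field A U Z \<longrightarrow>
        (\<forall>p\<in>U.
           D X Y p - D Y X p = lie_bracket A X Y p \<and>
           X p (\<lambda>q. g q (Y q) (Z q)) = g p (D X Y p) (Z p) + g p (Y p) (D X Z p)))"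

definition curvature :: "'m::topological_space chart set \<Rightarrow>
    ('m field \<Rightarrow> 'm field \<Rightarrow> 'm field) \<Rightarrow> 'm field \<Rightarrow> 'm field \<Rightarrow> 'm field \<Rightarrow> 'm field" where
  "curvature A D X Y Z = (\<lambda>p.
     D X (D Y Z) p - D Y (D X Z) p - D (lie_bracket A X Y) Z p)"


section \<open>Almost paracontact metric structures\<close>

definition almost_paracontact_metric :: "'m::topological_space chart set \<Rightarrow>
    ('m \<Rightarrow> 'm tangent \<Rightarrow> 'm tangent) \<Rightarrow> 'm field \<Rightarrow> ('m \<Rightarrow> 'm tangent \<Rightarrow> real) \<Rightarrow>
    ('m \<Rightarrow> 'm tangent \<Rightarrow> 'm tangent \<Rightarrow> real) \<Rightarrow> bool" where
  "almost_paracontact_metric A \<phi> \<xi> \<eta> g \<longleftrightarrow>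
     tensor11 A \<phi> \<and> vector_field A UNIV \<xi> \<and> one_form A \<eta> \<and> pseudo_riemannian_21 A g \<and>
     (\<forall>p. \<eta> p (\<xi> p) = 1) \<and>
     (\<forall>p. \<forall>u\<in>tangent_space A p. \<phi> p (\<phi> p u) = u - \<eta> p u *\<^sub>R \<xi> p) \<and>
     (\<forall>p. \<forall>u\<in>tangent_space A p. \<forall>v\<in>tangent_space A p.
        g p (\<phi> p u) (\<phi> p v) = - g p u v + \<eta> p u * \<eta> p v)"

definition fundamental_form :: "('m \<Rightarrow> 'm tangent \<Rightarrow> 'm tangent) \<Rightarrow>
    ('m \<Rightarrow> 'm tangent \<Rightarrow> 'm tangent \<Rightarrow> real) \<Rightarrow> 'm \<Rightarrow> 'm tangent \<Rightarrow> 'm tangent \<Rightarrow> real" where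
  "fundamental_form \<phi> g = (\<lambda>p u v. g p u (\<phi> p v))"

definition almost_paracosymplectic :: "'m::topological_space chart set \<Rightarrow>
    ('m \<Rightarrow> 'm tangent \<Rightarrow> 'm tangent) \<Rightarrow> 'm field \<Rightarrow> ('m \<Rightarrow> 'm tangent \<Rightarrow> real) \<Rightarrow>
    ('m \<Rightarrow> 'm tangent \<Rightarrow> 'm tangent \<Rightarrow> real) \<Rightarrow> bool" where
  "almost_paracosymplectic A \<phi> \<xi> \<eta> g \<longleftrightarrow>
     almost_paracontact_metric A \<phi> \<xi> \<eta> g \<and>
     (\<forall>U X Y. open U \<and> vector_field A U X \<and> vector_field A U Y \<longrightarrow>
        (\<forall>p\<in>U. ext_deriv1 A \<eta> X Y p = 0)) \<and>
     (\<forall>U X Y Z. open U \<and> vector_field A U X \<and> vector_field A U Y \<and> vector_field A U Z \<longrightarrow>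
        (\<forall>p\<in>U. ext_deriv2 A (fundamental_form \<phi> g) X Y Z p = 0))"

definition nijenhuis :: "'m::topological_space chart set \<Rightarrow>
    ('m \<Rightarrow> 'm tangent \<Rightarrow> 'm tangent) \<Rightarrow> 'm field \<Rightarrow> 'm field \<Rightarrow> 'm field" where
  "nijenhuis A \<phi> X Y = (\<lambda>p.
     \<phi> p (\<phi> p (lie_bracket A X Y p))
     + lie_bracket A (\<lambda>q. \<phi> q (X q)) (\<lambda>q. \<phi> q (Y q)) p
     - \<phi> p (lie_bracket A (\<lambda>q. \<phi> q (X q)) Y p + lie_bracket A X (\<lambda>q. \<phi> q (Y q)) p))"

definition normal_structure :: "'m::topological_space chart set \<Rightarrow>
    ('m \<Rightarrow> 'm tangent \<Rightarrow> 'm tangent) \<Rightarrow> 'm field \<Rightarrow> ('m \<Rightarrow> 'm tangent \<Rightarrow> real) \<Rightarrow> bool" where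
  "normal_structure A \<phi> \<xi> \<eta> \<longleftrightarrow>
     (\<forall>U X Y. open U \<and> vector_field A U X \<and> vector_field A U Y \<longrightarrow>
        (\<forall>p\<in>U. nijenhuis A \<phi> X Y p - (2 * ext_deriv1 A \<eta> X Y p) *\<^sub>R \<xi> p = 0))"

definition paracosymplectic :: "'m::topological_space chart set \<Rightarrow>
    ('m \<Rightarrow> 'm tangent \<Rightarrow> 'm tangent) \<Rightarrow> 'm field \<Rightarrow> ('m \<Rightarrow> 'm tangent \<Rightarrow> real) \<Rightarrow>
    ('m \<Rightarrow> 'm tangent \<Rightarrow> 'm tangent \<Rightarrow> real) \<Rightarrow> bool" where
  "paracosymplectic A \<phi> \<xi> \<eta> g \<longleftrightarrow>
     almost_paracosymplectic A \<phi> \<xi> \<eta> g \<and> normal_structure A \<phi> \<xi> \<eta>"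

definition h_tensor :: "'m::topological_space chart set \<Rightarrow>
    ('m \<Rightarrow> 'm tangent \<Rightarrow> 'm tangent) \<Rightarrow> 'm field \<Rightarrow> 'm field \<Rightarrow> 'm field" where
  "h_tensor A \<phi> \<xi> X = (\<lambda>p. (1/2) *\<^sub>R lie_deriv11 A \<xi> \<phi> X p)"

definition kappa_mu_space :: "'m::topological_space chart set \<Rightarrow>
    ('m \<Rightarrow> 'm tangent \<Rightarrow> 'm tangent) \<Rightarrow> 'm field \<Rightarrow> ('m \<Rightarrow> 'm tangent \<Rightarrow> real) \<Rightarrow>
    ('m field \<Rightarrow> 'm field \<Rightarrow> 'm field) \<Rightarrow> real \<Rightarrow> real \<Rightarrow> bool" where
  "kappa_mu_space A \<phi> \<xi> \<eta> D \<kappa> \<mu> \<longleftrightarrow>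
     (\<forall>U X Y. open U \<and> vector_field A U X \<and> vector_field A U Y \<longrightarrow>
        (\<forall>p\<in>U. curvature A D X Y \<xi> p =
           \<kappa> *\<^sub>R (\<eta> p (Y p) *\<^sub>R X p - \<eta> p (X p) *\<^sub>R Y p) +
           \<mu> *\<^sub>R (\<eta> p (Y p) *\<^sub>R h_tensor A \<phi> \<xi> X p - \<eta> p (X p) *\<^sub>R h_tensor A \<phi> \<xi> Y p)))"

definition local_frame :: "'m::topological_space chart set \<Rightarrow> 'm set \<Rightarrow>
    'm field \<Rightarrow> 'm field \<Rightarrow> 'm field \<Rightarrow> bool" where
  "local_frame A V X Y Z \<longleftrightarrow>
     vector_field A V X \<and> vector_field A V Y \<and> vector_field A V Z \<and>
     (\<forall>q\<in>V. distinct [X q, Y q, Z q] \<and> independent {X q, Y q, Z q} \<and>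
        span {X q, Y q, Z q} = tangent_space A q)"

definition artin_frame :: "'m::topological_space chart set \<Rightarrow>
    ('m \<Rightarrow> 'm tangent \<Rightarrow> 'm tangent) \<Rightarrow> 'm field \<Rightarrow>
    ('m \<Rightarrow> 'm tangent \<Rightarrow> 'm tangent \<Rightarrow> real) \<Rightarrow> 'm set \<Rightarrow> 'm field \<Rightarrow> 'm field \<Rightarrow> bool" where
  "artin_frame A \<phi> \<xi> g V E\<^sub>1 E\<^sub>2 \<longleftrightarrow>
     local_frame A V \<xi> E\<^sub>1 E\<^sub>2 \<and>
     (\<forall>q\<in>V. \<phi> q (E\<^sub>1 q) = E\<^sub>1 q \<and> \<phi> q (E\<^sub>2 q) = - E\<^sub>2 q \<and>
        g q (\<xi> q) (E\<^sub>1 q) = 0 \<and> g q (\<xi> q) (E\<^sub>2 q) = 0 \<and> g q (E\<^sub>1 q) (E\<^sub>2 q) = 1)"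

end

theory Submission
  imports Defs
begin

text \<open>Given \<open>X\<close> with \<open>\<phi> X = X\<close> and \<open>h X \<noteq> 0\<close>, the field \<open>W = h X\<close> satisfies \<open>\<phi> W = - W\<close>, and
  \<open>a = g(X, W)\<close> has no zeros because \<open>h\<close> is tensorial and the eigenspaces of \<open>\<phi>\<close> in \<open>ker \<eta>\<close>
  are dual null lines. Rescaling \<open>X\<close> and \<open>W\<close> by \<open>\<bar>a\<bar>\<close> to the power \<open>- 1/2\<close> gives an Artin frame with
  \<open>h E\<^sub>1 = \<epsilon> E\<^sub>2\<close>, where \<open>\<epsilon>\<close> is the sign of \<open>a\<close>. The metric, \<open>d\<eta> = 0\<close> and \<open>d\<Phi> = 0\<close> (which makes
  \<open>\<xi>\<close> divergence free) leave four unknown connection coefficients; the \<open>\<xi>\<close>-curvature identity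
  for \<open>(E\<^sub>1, \<xi>)\<close> fixes two of them, and for \<open>(E\<^sub>1, E\<^sub>2)\<close> it gives \<open>\<nabla>\<close> of \<open>E\<^sub>1\<close> along \<open>E\<^sub>2\<close> zero and
  \<open>\<kappa> b = 0\<close>.\<close>

subsection \<open>Calculus of smooth functions\<close>

text \<open>The derivative at a point of an open set sees only nearby values, so the directional
  derivatives of \<open>f\<close> and \<open>g\<close> agree on \<open>S\<close> and the induction
  hypothesis applies to them. Values off \<open>S\<close> stay arbitrary.\<close>

lemma Ck_on_cong:
  assumes "open S" "\<And>x. x \<in> S \<Longrightarrow> f x = g x" "Ck_on k S f"
  shows "Ck_on k S g"
  using assms(2,3)
proof (induction k arbitrary: f g)
  case 0
  then show ?case by (auto cong: continuous_on_cong)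
next
  case (Suc k)
  have d: "(g has_derivative frechet_derivative f (at x)) (at x)" if "x \<in> S" for x
  proof -
    have "(f has_derivative frechet_derivative f (at x)) (at x)"
      using Suc.prems(2) that by (simp add: frechet_derivative_works)
    then show ?thesis
      by (rule has_derivative_transform_within_open[OF _ \<open>open S\<close> that]) (use Suc.prems(1) in auto)
  qed
  have "frechet_derivative g (at x) = frechet_derivative f (at x)" if "x \<in> S" for x
    using frechet_derivative_at[OF d[OF that]] by simp
  then have "Ck_on k S (\<lambda>x. frechet_derivative g (at x) v)" for v
    using Suc.prems(2) by (rule_tac Suc.IH[of "\<lambda>x. frechet_derivative f (at x) v"]) auto
  then show ?case
    using d by (auto simp: differentiable_def)
qed

text \<open>Uniqueness of the derivative identifies an explicit \<open>f'\<close> with the chosen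
  \<open>frechet_derivative\<close>. The closure proofs below take their induction step from this
  rule.\<close>

lemma Ck_on_SucI:
  assumes "open S" "\<And>x. x \<in> S \<Longrightarrow> (f has_derivative f' x) (at x)"
    and "\<And>v. Ck_on k S (\<lambda>x. f' x v)"
  shows "Ck_on (Suc k) S f"
proof -
  have "f' x = frechet_derivative f (at x)" if "x \<in> S" for x
    by (rule frechet_derivative_at[OF assms(2)[OF that]])
  then have "Ck_on k S (\<lambda>x. frechet_derivative f (at x) v)" for v
    by (rule_tac Ck_on_cong[OF assms(1) _ assms(3)[of v]]) auto
  then show ?thesis
    using assms(2) by (auto simp: differentiable_def)
qed

lemma Ck_on_has_derivative:
  assumes "Ck_on (Suc k) S f" "x \<in> S"
  shows "(f has_derivative frechet_derivative f (at x)) (at x)"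
  using assms by (simp add: frechet_derivative_works)

lemma Ck_on_Suc_imp:
  "Ck_on (Suc k) S f \<Longrightarrow> Ck_on k S f"
proof (induction k arbitrary: f)
  case 0
  then show ?case
    by (auto intro!: continuous_at_imp_continuous_on differentiable_imp_continuous_within)
next
  case (Suc k)
  show ?case
    using Suc.prems Suc.IH by (subst (asm) Ck_on.simps(2)) (subst Ck_on.simps(2), blast)
qed

lemma Ck_on_subset:
  "Ck_on k S f \<Longrightarrow> T \<subseteq> S \<Longrightarrow> Ck_on k T f"
proof (induction k arbitrary: f)
  case 0
  then show ?case by (auto intro: continuous_on_subset)
next
  case (Suc k)
  then show ?case
    by (fastforce simp del: Ck_on.simps(1))
qed

lemma Ck_on_const: "open S \<Longrightarrow> Ck_on k S (\<lambda>x. c)"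
proof (induction k arbitrary: c)
  case (Suc k)
  then show ?case
    by (intro Ck_on_SucI[where f' = "\<lambda>_ _. 0"]) auto
qed auto

lemma Ck_on_add:
  "open S \<Longrightarrow> Ck_on k S f \<Longrightarrow> Ck_on k S g \<Longrightarrow> Ck_on k S (\<lambda>x. f x + g x)"
proof (induction k arbitrary: f g)
  case 0
  then show ?case by (auto intro: continuous_intros)
next
  case (Suc k)
  show ?case
    by (rule Ck_on_SucI[OF Suc.prems(1)
        has_derivative_add[OF Ck_on_has_derivative[OF Suc.prems(2)] Ck_on_has_derivative[OF Suc.prems(3)]]])
      (use Suc in \<open>auto intro!: Suc.IH\<close>)
qed

lemma Ck_on_sum:
  assumes "open S" "\<And>i. i \<in> I \<Longrightarrow> Ck_on k S (f i)"
  shows "Ck_on k S (\<lambda>x. \<Sum>i\<in>I. f i x)"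
  using assms(2)
proof (induction I rule: infinite_finite_induct)
  case (insert i I)
  then show ?case
    by (simp add: Ck_on_add assms(1))
qed (simp_all add: Ck_on_const assms(1))

lemma Ck_on_mult:
  fixes f g :: "'a::euclidean_space \<Rightarrow> real"
  shows "open S \<Longrightarrow> Ck_on k S f \<Longrightarrow> Ck_on k S g \<Longrightarrow> Ck_on k S (\<lambda>x. f x * g x)"
proof (induction k arbitrary: f g)
  case 0
  then show ?case by (auto intro: continuous_intros)
next
  case (Suc k)
  show ?case
  proof (rule Ck_on_SucI[OF Suc.prems(1)
        has_derivative_mult[OF Ck_on_has_derivative[OF Suc.prems(2)] Ck_on_has_derivative[OF Suc.prems(3)]]])
    fix v
    \<comment> \<open>Each summand of the product rule keeps one undifferentiated factor, so both
      factors are first lowered to class \<open>k\<close>.\<close>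
    have "Ck_on k S f" "Ck_on k S g"
      using Suc.prems Ck_on_Suc_imp by blast+
    then show "Ck_on k S (\<lambda>x. f x * frechet_derivative g (at x) v + frechet_derivative f (at x) v * g x)"
      using Suc by (intro Ck_on_add Suc.IH) auto
  qed
qed

lemma Ck_on_bounded_linear:
  assumes "bounded_linear l"
  shows "open S \<Longrightarrow> Ck_on k S f \<Longrightarrow> Ck_on k S (\<lambda>x. l (f x))"
proof (induction k arbitrary: f)
  case 0
  then show ?case
    using bounded_linear.continuous_on[OF assms] by auto
next
  case (Suc k)
  show ?case
    by (rule Ck_on_SucI[OF Suc.prems(1)
        bounded_linear.has_derivative[OF assms Ck_on_has_derivative[OF Suc.prems(2)]]])
      (use Suc in auto)
qed

lemma Cinf_on_imp_Ck_on: "Cinf_on S f \<Longrightarrow> Ck_on k S f"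
  by (simp only: Cinf_on_def)

lemma Cinf_on_deriv:
  assumes "Cinf_on S f"
  shows "Cinf_on S (\<lambda>x. frechet_derivative f (at x) v)"
  unfolding Cinf_on_def
proof
  show "Ck_on k S (\<lambda>x. frechet_derivative f (at x) v)" for k
    using Cinf_on_imp_Ck_on[OF assms, of "Suc k"] by simp
qed

text \<open>Differentiation replaces the exponent \<open>s\<close> by \<open>s - 1\<close>, so the
  induction treats all exponents at once.\<close>

lemma Ck_on_powr:
  fixes f :: "'a::euclidean_space \<Rightarrow> real"
  assumes "open S" "\<And>x. x \<in> S \<Longrightarrow> f x > 0" "Cinf_on S f"
  shows "Ck_on k S (\<lambda>x. f x powr s)"
proof (induction k arbitrary: s)
  case 0
  have "continuous_on S f"
    using Cinf_on_imp_Ck_on[OF assms(3), of 0] by simp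
  then show ?case
    using assms(2) by (fastforce intro!: continuous_intros)
next
  case (Suc k)
  have f: "Ck_on j S f" for j
    using assms(3) by (simp add: Cinf_on_def)
  have d: "((\<lambda>x. f x powr s) has_derivative
      (\<lambda>v. s * f x powr (s - 1) * frechet_derivative f (at x) v)) (at x)" if "x \<in> S" for x
  proof -
    have "((\<lambda>y. y powr s) has_real_derivative s * f x powr (s - 1)) (at (f x))"
      using assms(2)[OF that] by (rule has_real_derivative_powr)
    then have "((\<lambda>y. y powr s) has_derivative (*) (s * f x powr (s - 1))) (at (f x))"
      by (simp add: has_field_derivative_def)
    from has_derivative_compose[OF Ck_on_has_derivative[OF f that] this]
    show ?thesis by simp
  qed
  have f': "Ck_on k S (\<lambda>x. frechet_derivative f (at x) v)" for v
    using f[of "Suc k"] by simp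
  show ?case
    by (rule Ck_on_SucI[OF assms(1) d], assumption)
      (intro Ck_on_mult Ck_on_const assms(1) Suc.IH f')
qed

text \<open>By the chain rule the derivative is a sum of components of the derivative of
  \<open>g\<close> times partial derivatives of \<open>f\<close> along \<open>g\<close>. These
  partial derivatives are again smooth on \<open>T\<close>, so the induction hypothesis, stated for
  all \<open>f\<close>, covers them.\<close>

lemma Ck_on_compose:
  fixes f :: "'b::euclidean_space \<Rightarrow> real" and g :: "'a::euclidean_space \<Rightarrow> 'b"
  assumes "open S" "g ` S \<subseteq> T" "Cinf_on S g"
  shows "Cinf_on T f \<Longrightarrow> Ck_on k S (\<lambda>x. f (g x))"
proof (induction k arbitrary: f)
  case 0
  have "continuous_on S g" "continuous_on T f"
    using Cinf_on_imp_Ck_on[OF assms(3), of 0] Cinf_on_imp_Ck_on[OF 0, of 0] by simp_all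
  then show ?case
    using assms(2) by (auto intro: continuous_on_compose2)
next
  case (Suc k)
  have f: "Ck_on j T f" and g: "Ck_on j S g" for j
    using assms(3) Suc.prems by (simp_all add: Cinf_on_def)
  let ?f' = "\<lambda>b x. frechet_derivative f (at x) b" and ?g' = "\<lambda>x v. frechet_derivative g (at x) v"
  have d: "((\<lambda>x. f (g x)) has_derivative (\<lambda>v. \<Sum>b\<in>Basis. (?g' x v \<bullet> b) * ?f' b (g x))) (at x)"
    if "x \<in> S" for x
  proof -
    have fd: "(f has_derivative frechet_derivative f (at (g x))) (at (g x))"
      using Ck_on_has_derivative[OF f] that assms(2) by blast
    interpret l: linear "frechet_derivative f (at (g x))"
      using fd by (rule has_derivative_linear)
    \<comment> \<open>The direction \<open>w\<close> will be the derivative of \<open>g\<close>,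
      which varies with the point, whereas \<open>Ck_on\<close> controls fixed directions only.
      Expansion in the basis separates the two dependences.\<close>
    have rep: "frechet_derivative f (at (g x)) w = (\<Sum>b\<in>Basis. (w \<bullet> b) * ?f' b (g x))" for w
    proof -
      have "frechet_derivative f (at (g x)) w
          = frechet_derivative f (at (g x)) (\<Sum>b\<in>Basis. (w \<bullet> b) *\<^sub>R b)"
        by (simp only: euclidean_representation)
      then show ?thesis
        by (simp only: l.sum l.scaleR real_scaleR_def)
    qed
    show ?thesis
      by (rule has_derivative_eq_rhs[OF has_derivative_compose[OF Ck_on_has_derivative[OF g that] fd]])
        (rule ext, rule rep)
  qed
  have f': "Cinf_on T (?f' b)" for b
    using Suc.prems by (rule Cinf_on_deriv)
  have g': "Ck_on k S (\<lambda>x. ?g' x v)" for v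
    using g[of "Suc k"] by simp
  show ?case
    by (rule Ck_on_SucI[OF assms(1) d], assumption)
      (intro Ck_on_sum Ck_on_mult assms(1) Suc.IH f' g'
        Ck_on_bounded_linear[OF bounded_linear_inner_left])
qed

section \<open>Closure properties of infinitely differentiable functions\<close>

lemma Cinf_on_const: "open S \<Longrightarrow> Cinf_on S (\<lambda>x. c)"
  by (simp only: Cinf_on_def Ck_on_const simp_thms)

lemma Cinf_on_add:
  "open S \<Longrightarrow> Cinf_on S f \<Longrightarrow> Cinf_on S g \<Longrightarrow> Cinf_on S (\<lambda>x. f x + g x)"
  by (simp only: Cinf_on_def Ck_on_add simp_thms)

lemma Cinf_on_mult:
  fixes f g :: "'a::euclidean_space \<Rightarrow> real"
  shows "open S \<Longrightarrow> Cinf_on S f \<Longrightarrow> Cinf_on S g \<Longrightarrow> Cinf_on S (\<lambda>x. f x * g x)"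
  by (simp only: Cinf_on_def Ck_on_mult simp_thms)

lemma Cinf_on_bounded_linear:
  "bounded_linear l \<Longrightarrow> open S \<Longrightarrow> Cinf_on S f \<Longrightarrow> Cinf_on S (\<lambda>x. l (f x))"
  by (simp only: Cinf_on_def Ck_on_bounded_linear simp_thms)

lemma Cinf_on_compose:
  fixes f :: "'b::euclidean_space \<Rightarrow> real" and g :: "'a::euclidean_space \<Rightarrow> 'b"
  assumes "open S" "g ` S \<subseteq> T" "Cinf_on S g" "Cinf_on T f"
  shows "Cinf_on S (\<lambda>x. f (g x))"
  using Ck_on_compose[OF assms] by (simp add: Cinf_on_def)

lemma Cinf_on_cong:
  assumes "open S" "\<And>x. x \<in> S \<Longrightarrow> f x = g x" "Cinf_on S f"
  shows "Cinf_on S g"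
  using Ck_on_cong[OF assms(1,2)] assms(3) by (auto simp: Cinf_on_def)

lemma Cinf_on_subset: "Cinf_on S f \<Longrightarrow> T \<subseteq> S \<Longrightarrow> Cinf_on T f"
  unfolding Cinf_on_def by (blast intro: Ck_on_subset)


subsection \<open>Smooth functions and derivations on a manifold\<close>

locale atlas3 =
  fixes A :: "'m::{t2_space, second_countable_topology} chart set"
  assumes manifold: "manifold3 A"
begin

section \<open>Charts and transition maps\<close>

lemma chart_open: "(V, c) \<in> A \<Longrightarrow> open V"
  using manifold by (fastforce simp: manifold3_def is_chart_def)

lemma chart_inj:
  assumes "(V, c) \<in> A" shows "inj_on c V"
proof -
  have "homeomorphism V (c ` V) c (inv_into V c)"
    using manifold assms by (fastforce simp: manifold3_def is_chart_def)
  then show ?thesis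
    by (metis homeomorphism_def inj_on_inverseI)
qed

lemma chart_cont: "(V, c) \<in> A \<Longrightarrow> continuous_on V c"
  using manifold by (fastforce simp: manifold3_def is_chart_def homeomorphism_def)

lemma chart_image_open:
  assumes "(V, c) \<in> A" "open U"
  shows "open (c ` (U \<inter> V))"
proof -
  have h: "homeomorphism V (c ` V) c (inv_into V c)" and o: "open (c ` V)"
    using manifold assms by (fastforce simp: manifold3_def is_chart_def)+
  have "openin (top_of_set V) (U \<inter> V)"
    using openin_open_Int[OF assms(2), of V] by (simp add: Int_commute)
  from homeomorphism_imp_open_map[OF h this] show ?thesis
    using o openin_open_trans by blast
qed

lemma chart_exists: obtains V c where "(V, c) \<in> A" "p \<in> V"
  using manifold unfolding manifold3_def by blast

lemma transition:
  "(V, c) \<in> A \<Longrightarrow> (W, d) \<in> A \<Longrightarrow> Cinf_on (c ` (V \<inter> W)) (d \<circ> inv_into V c)"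
  using manifold by (fastforce simp: manifold3_def)

section \<open>Algebra and continuity of smooth functions\<close>

lemma smooth_fun_cong:
  assumes "open U" "\<And>q. q \<in> U \<Longrightarrow> f q = g q" "smooth_fun A U f"
  shows "smooth_fun A U g"
  unfolding smooth_fun_def
proof clarify
  fix V c assume V: "(V, c) \<in> A"
  have "Cinf_on (c ` (U \<inter> V)) (f \<circ> inv_into V c)"
    using assms(3) V by (auto simp: smooth_fun_def)
  then show "Cinf_on (c ` (U \<inter> V)) (g \<circ> inv_into V c)"
    by (rule Cinf_on_cong[OF chart_image_open[OF V assms(1)], rotated])
      (use assms(2) chart_inj[OF V] in auto)
qed

lemma smooth_fun_subset:
  assumes "smooth_fun A U f" "W \<subseteq> U"
  shows "smooth_fun A W f"
proof -
  have "c ` (W \<inter> V) \<subseteq> c ` (U \<inter> V)" for c :: "'m \<Rightarrow> real^3" and V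
    using assms(2) by blast
  then show ?thesis
    using assms(1) unfolding smooth_fun_def by (fast intro: Cinf_on_subset)
qed

lemma smooth_fun_const: "open U \<Longrightarrow> smooth_fun A U (\<lambda>q. a)"
  by (auto simp: smooth_fun_def o_def intro: Cinf_on_const chart_image_open)

lemma smooth_fun_add:
  "open U \<Longrightarrow> smooth_fun A U f \<Longrightarrow> smooth_fun A U g \<Longrightarrow> smooth_fun A U (\<lambda>q. f q + g q)"
  by (fastforce simp: smooth_fun_def o_def intro: Cinf_on_add chart_image_open)

lemma smooth_fun_mult:
  "open U \<Longrightarrow> smooth_fun A U f \<Longrightarrow> smooth_fun A U g \<Longrightarrow> smooth_fun A U (\<lambda>q. f q * g q)"
  by (fastforce simp: smooth_fun_def o_def intro: Cinf_on_mult chart_image_open)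

lemma smooth_fun_powr:
  assumes "open U" "smooth_fun A U f" "\<And>q. q \<in> U \<Longrightarrow> f q > 0"
  shows "smooth_fun A U (\<lambda>q. f q powr s)"
  unfolding smooth_fun_def
proof clarify
  fix V c assume V: "(V, c) \<in> A"
  have f: "Cinf_on (c ` (U \<inter> V)) (\<lambda>x. f (inv_into V c x))"
    using assms(2) V by (auto simp: smooth_fun_def o_def)
  have "f (inv_into V c x) > 0" if "x \<in> c ` (U \<inter> V)" for x
    using that assms(3) chart_inj[OF V] by auto
  from Ck_on_powr[OF chart_image_open[OF V assms(1)] this f]
  show "Cinf_on (c ` (U \<inter> V)) ((\<lambda>q. f q powr s) \<circ> inv_into V c)"
    by (simp add: Cinf_on_def o_def)
qed

text \<open>The reciprocal is \<open>f\<close> divided by its square; squaring makes the base of the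
  power positive whatever the sign of \<open>f\<close>.\<close>

lemma smooth_fun_inverse:
  assumes "open U" "smooth_fun A U f" "\<And>q. q \<in> U \<Longrightarrow> f q \<noteq> 0"
  shows "smooth_fun A U (\<lambda>q. inverse (f q))"
proof (rule smooth_fun_cong[OF assms(1)])
  show "smooth_fun A U (\<lambda>q. f q * (f q * f q) powr (- 1))"
    using assms by (intro smooth_fun_mult smooth_fun_powr) (auto simp: zero_less_mult_iff linorder_neq_iff)
  show "f q * (f q * f q) powr (- 1) = inverse (f q)" if "q \<in> U" for q
    using assms(3)[OF that] by (simp add: powr_minus field_simps)
qed

text \<open>On a chart domain \<open>f\<close> is its coordinate expression composed with the chart,
  and both are continuous there.\<close>

lemma smooth_fun_continuous:
  assumes "open U" "smooth_fun A U f"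
  shows "continuous_on U f"
proof (rule continuous_at_imp_continuous_on, rule ballI)
  fix q assume q: "q \<in> U"
  obtain V c where V: "(V, c) \<in> A" "q \<in> V" by (rule chart_exists)
  have "continuous_on (c ` (U \<inter> V)) (f \<circ> inv_into V c)"
    using assms(2) V Cinf_on_imp_Ck_on[where k = 0] by (fastforce simp: smooth_fun_def)
  then have "continuous_on (U \<inter> V) ((f \<circ> inv_into V c) \<circ> c)"
    by (rule continuous_on_compose[OF continuous_on_subset[OF chart_cont[OF V(1)]], rotated]) simp
  then have "continuous_on (U \<inter> V) f"
    by (rule continuous_on_eq) (use chart_inj[OF V(1)] in auto)
  then show "isCont f q"
    using q V assms(1) chart_open[OF V(1)] continuous_on_eq_continuous_at[of "U \<inter> V"] by auto
qed

lemma smooth_fun_open_pos: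
  assumes "open U" "smooth_fun A U f"
  shows "open {q \<in> U. f q > 0}"
proof -
  have "open (U \<inter> f -` {0<..})"
    by (rule continuous_open_preimage[OF smooth_fun_continuous[OF assms] assms(1)]) simp
  moreover have "U \<inter> f -` {0<..} = {q \<in> U. f q > 0}" by auto
  ultimately show ?thesis by simp
qed

section \<open>Germs of smooth functions\<close>

lemma smooth_atI: "open U \<Longrightarrow> q \<in> U \<Longrightarrow> smooth_fun A U f \<Longrightarrow> smooth_at A q f"
  by (auto simp: smooth_at_def)

lemma smooth_at_common:
  assumes "smooth_at A q f" "smooth_at A q g"
  obtains U where "open U" "q \<in> U" "smooth_fun A U f" "smooth_fun A U g"
proof -
  obtain U W where "open U" "q \<in> U" "smooth_fun A U f" "open W" "q \<in> W" "smooth_fun A W g"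
    using assms by (auto simp: smooth_at_def)
  then show ?thesis
    by (intro that[of "U \<inter> W"]) (auto intro: smooth_fun_subset)
qed

lemma smooth_at_add: "smooth_at A q f \<Longrightarrow> smooth_at A q g \<Longrightarrow> smooth_at A q (\<lambda>q. f q + g q)"
  by (erule (1) smooth_at_common) (auto intro: smooth_atI smooth_fun_add)

lemma smooth_at_mult: "smooth_at A q f \<Longrightarrow> smooth_at A q g \<Longrightarrow> smooth_at A q (\<lambda>q. f q * g q)"
  by (erule (1) smooth_at_common) (auto intro: smooth_atI smooth_fun_mult)

lemma smooth_at_const: "smooth_at A q (\<lambda>q. a)"
  by (rule smooth_atI[of UNIV]) (auto intro: smooth_fun_const)

lemma smooth_at_cong:
  assumes "open N" "q \<in> N" "\<And>x. x \<in> N \<Longrightarrow> f x = g x" "smooth_at A q f"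
  shows "smooth_at A q g"
proof -
  obtain U where U: "open U" "q \<in> U" "smooth_fun A U f"
    using assms(4) by (auto simp: smooth_at_def)
  have "smooth_fun A (U \<inter> N) f"
    using U(3) by (rule smooth_fun_subset) simp
  then have "smooth_fun A (U \<inter> N) g"
    by (rule smooth_fun_cong[rotated 2]) (use U assms in auto)
  then show ?thesis
    by (rule smooth_atI[rotated 2]) (use U assms in auto)
qed

section \<open>Derivations at a point\<close>

lemma tangent_add:
  "v \<in> tangent_space A q \<Longrightarrow> smooth_at A q f \<Longrightarrow> smooth_at A q g \<Longrightarrow>
    v (\<lambda>x. f x + g x) = v f + v g"
  by (simp add: tangent_space_def)

lemma tangent_mult:
  "v \<in> tangent_space A q \<Longrightarrow> smooth_at A q f \<Longrightarrow> smooth_at A q g \<Longrightarrow>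
    v (\<lambda>x. f x * g x) = f q * v g + g q * v f"
  by (simp add: tangent_space_def)

lemma tangent_scale:
  "v \<in> tangent_space A q \<Longrightarrow> smooth_at A q f \<Longrightarrow> v (\<lambda>x. a * f x) = a * v f"
  by (simp add: tangent_space_def)

text \<open>The Leibniz rule for \<open>1 * 1\<close> makes the value at the constant 1 equal to its
  own double, hence zero; homogeneity gives the other constants.\<close>

lemma tangent_const:
  assumes "v \<in> tangent_space A q"
  shows "v (\<lambda>x. a) = 0"
proof -
  have "v (\<lambda>x. 1) = 0"
    using tangent_mult[OF assms smooth_at_const[of _ 1] smooth_at_const[of _ 1]] by simp
  then show ?thesis
    using tangent_scale[OF assms smooth_at_const[of _ 1], of a] by simp
qed

text \<open>A function vanishing near a point is its own product with a function that vanishes there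
  and equals 1 elsewhere, so the Leibniz rule makes derivations local.\<close>

lemma tangent_local:
  assumes "v \<in> tangent_space A q" "open N" "q \<in> N" "\<And>x. x \<in> N \<Longrightarrow> f x = g x"
  shows "v f = v g"
proof (cases "smooth_at A q f")
  case False
  then have "\<not> smooth_at A q g"
    using smooth_at_cong[OF assms(2,3), of g f] assms(4) by auto
  with False assms(1) show ?thesis
    by (simp add: tangent_space_def)
next
  case True
  define u where "u x = g x - f x" for x
  define \<psi> where "\<psi> x = (if x \<in> N then 0 else (1::real))" for x
  have "smooth_at A q u" "smooth_at A q \<psi>"
    by (rule smooth_at_cong[OF assms(2,3) _ smooth_at_const[of _ 0]]; simp add: u_def \<psi>_def assms(4))+
  moreover have "u = (\<lambda>x. \<psi> x * u x)" "u q = 0" "\<psi> q = 0"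
    by (auto simp: u_def \<psi>_def assms(3,4))
  ultimately have "v u = 0"
    using tangent_mult[OF assms(1), of \<psi> u] by simp
  moreover have "g = (\<lambda>x. f x + u x)" by (simp add: u_def)
  ultimately show ?thesis
    using tangent_add[OF assms(1) True \<open>smooth_at A q u\<close>] by simp
qed

end


subsection \<open>Three-dimensional linear algebra\<close>

text \<open>A vector of \<open>span T\<close> outside \<open>span S\<close> would enlarge
  \<open>S\<close> to an independent set in \<open>span T\<close> with more elements than
  \<open>T\<close>. This replaces a dimension count, since tangent vectors live in a large space of
  functions.\<close>

lemma span_eq_of_independent_card:
  fixes S T :: "'v::real_vector set"
  assumes "independent S" "S \<subseteq> span T" "finite T" "card T \<le> card S"
  shows "span S = span T"
proof
  show "span S \<subseteq> span T"
    using assms(2) by (simp add: span_minimal)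
  show "span T \<subseteq> span S"
  proof (rule ccontr)
    assume "\<not> span T \<subseteq> span S"
    then obtain t where t: "t \<in> span T" "t \<notin> span S" by blast
    then have "independent (insert t S)"
      using assms(1) by (simp add: independent_insertI)
    then have "finite (insert t S) \<and> card (insert t S) \<le> card T"
      using independent_span_bound[OF assms(3), of "insert t S"] t(1) assms(2) by simp
    moreover have "t \<notin> S"
      using t(2) span_base by blast
    ultimately show False
      using assms(4) by auto
  qed
qed

text \<open>Independence of a set does not notice repeated vectors, so distinctness is concluded as
  well: coefficients 1 and -1 on two equal vectors would violate the hypothesis.\<close>

lemma independent3I:
  fixes u v w :: "'v::real_vector"
  assumes "\<And>a b c. a *\<^sub>R u + b *\<^sub>R v + c *\<^sub>R w = 0 \<Longrightarrow> a = 0 \<and> b = 0 \<and> c = 0"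
  shows "distinct [u, v, w] \<and> independent {u, v, w}"
proof -
  have d: "u \<noteq> v" "u \<noteq> w" "v \<noteq> w"
    using assms[of 1 "-1" 0] assms[of 1 0 "-1"] assms[of 0 1 "-1"] by auto
  have "f u = 0 \<and> f v = 0 \<and> f w = 0" if "(\<Sum>x\<in>{u, v, w}. f x *\<^sub>R x) = 0" for f
    using assms[of "f u" "f v" "f w"] that d by (simp add: add.assoc)
  then have "independent {u, v, w}"
    by (subst dependent_finite) auto
  with d show ?thesis by simp
qed

lemma span3E:
  fixes x :: "'v::real_vector"
  assumes "x \<in> span {u, v, w}"
  obtains a b c where "x = a *\<^sub>R u + b *\<^sub>R v + c *\<^sub>R w"
proof -
  obtain a b c where "x - a *\<^sub>R u - b *\<^sub>R v - c *\<^sub>R w = 0"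
    using assms by (auto simp: span_breakdown_eq)
  then show ?thesis
    by (intro that[of a b c]) (simp add: algebra_simps)
qed


subsection \<open>Vector fields\<close>

context atlas3
begin

lemma tangent_space_add [simp]:
  "u \<in> tangent_space A q \<Longrightarrow> v \<in> tangent_space A q \<Longrightarrow> u + v \<in> tangent_space A q"
  by (auto simp: tangent_space_def algebra_simps)

lemma tangent_space_scale [simp]:
  "u \<in> tangent_space A q \<Longrightarrow> a *\<^sub>R u \<in> tangent_space A q"
  by (auto simp: tangent_space_def scaleR_fun_def algebra_simps)

lemma tangent_space_zero [simp]: "0 \<in> tangent_space A q"
  by (auto simp: tangent_space_def)

lemma tangent_space_uminus [simp]:
  "u \<in> tangent_space A q \<Longrightarrow> - u \<in> tangent_space A q"
  using tangent_space_scale[of u q "-1"] by simp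

lemma tangent_space_diff [simp]:
  "u \<in> tangent_space A q \<Longrightarrow> v \<in> tangent_space A q \<Longrightarrow> u - v \<in> tangent_space A q"
  using tangent_space_add[of u q "- v"] by simp

lemma vector_field_tangent [intro]:
  "vector_field A U X \<Longrightarrow> q \<in> U \<Longrightarrow> X q \<in> tangent_space A q"
  by (auto simp: vector_field_def)

lemma vector_field_subset:
  assumes "vector_field A U X" "V \<subseteq> U"
  shows "vector_field A V X"
  using assms(1) subset_trans[OF _ assms(2)] subsetD[OF assms(2)] by (simp add: vector_field_def)

lemma vector_field_cong:
  assumes "vector_field A U X" "\<And>q. q \<in> U \<Longrightarrow> X q = Y q"
  shows "vector_field A U Y"
  unfolding vector_field_def
proof safe
  fix q assume "q \<in> U"
  then show "Y q \<in> tangent_space A q"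
    using vector_field_tangent[OF assms(1)] assms(2) by metis
next
  fix W f assume W: "open W" "W \<subseteq> U" "smooth_fun A W f"
  then have "smooth_fun A W (\<lambda>q. X q f)"
    using assms(1) by (auto simp: vector_field_def)
  then show "smooth_fun A W (\<lambda>q. Y q f)"
    by (rule smooth_fun_cong[OF W(1), rotated]) (use assms(2) W in auto)
qed

lemma vector_field_add:
  assumes "vector_field A U X" "vector_field A U Y"
  shows "vector_field A U (X + Y)"
  using assms by (auto simp: vector_field_def intro: smooth_fun_add)

lemma vector_field_fmult:
  assumes "vector_field A U X" "smooth_fun A U f"
  shows "vector_field A U (fmult f X)"
  unfolding vector_field_def
proof safe
  fix q assume "q \<in> U"
  then show "fmult f X q \<in> tangent_space A q"
    using vector_field_tangent[OF assms(1)] by (simp add: fmult_def)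
next
  fix W h assume "open W" "W \<subseteq> U" "smooth_fun A W h"
  then have "smooth_fun A W (\<lambda>q. f q * X q h)"
    using assms by (intro smooth_fun_mult) (auto simp: vector_field_def intro: smooth_fun_subset)
  then show "smooth_fun A W (\<lambda>q. fmult f X q h)"
    by (simp add: fmult_def scaleR_fun_def)
qed

lemma vector_field_scale:
  assumes "open U" "vector_field A U X"
  shows "vector_field A U (fmult (\<lambda>_. a) X)"
  using assms vector_field_fmult smooth_fun_const by blast

lemma vector_field_diff:
  assumes "open U" "vector_field A U X" "vector_field A U Y"
  shows "vector_field A U (X - Y)"
proof -
  have "X - Y = X + fmult (\<lambda>_. - 1) Y"
    by (auto simp: fmult_def fun_eq_iff scaleR_fun_def)
  then show ?thesis
    using vector_field_add[OF assms(2) vector_field_scale[OF assms(1,3)]] by metis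
qed


subsection \<open>Coordinate vector fields\<close>

text \<open>The partial derivative along the \<open>i\<close>-th coordinate of the chart. The value
  0 off the smooth germs is what the uniqueness clause of \<open>tangent_space\<close>
  requires.\<close>

definition coord_field :: "'m set \<Rightarrow> ('m \<Rightarrow> real^3) \<Rightarrow> 3 \<Rightarrow> 'm field" where
  "coord_field V c i = (\<lambda>q f. if smooth_at A q f
     then frechet_derivative (f \<circ> inv_into V c) (at (c q)) (axis i 1) else 0)"

lemma chart_inv [simp]: "(V, c) \<in> A \<Longrightarrow> q \<in> V \<Longrightarrow> inv_into V c (c q) = q"
  using chart_inj by simp

lemma smooth_at_has_derivative:
  assumes "(V, c) \<in> A" "q \<in> V" "smooth_at A q f"
  shows "((\<lambda>x. f (inv_into V c x)) has_derivative
      frechet_derivative (\<lambda>x. f (inv_into V c x)) (at (c q))) (at (c q))"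
proof -
  obtain U where U: "open U" "q \<in> U" "smooth_fun A U f"
    using assms(3) by (auto simp: smooth_at_def)
  have "Cinf_on (c ` (U \<inter> V)) (\<lambda>x. f (inv_into V c x))"
    using U(3) assms(1) by (auto simp: smooth_fun_def o_def)
  from Cinf_on_imp_Ck_on[OF this] show ?thesis
    by (rule Ck_on_has_derivative[of 0]) (use assms U in auto)
qed

lemma coord_field_tangent:
  assumes "(V, c) \<in> A" "q \<in> V"
  shows "coord_field V c i q \<in> tangent_space A q"
proof -
  have add: "coord_field V c i q (\<lambda>x. f x + h x) = coord_field V c i q f + coord_field V c i q h"
    and mult: "coord_field V c i q (\<lambda>x. f x * h x) = f q * coord_field V c i q h + h q * coord_field V c i q f"
    if "smooth_at A q f" "smooth_at A q h" for f h
    using that assms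
      frechet_derivative_at[OF has_derivative_add[OF smooth_at_has_derivative[OF assms that(1)]
          smooth_at_has_derivative[OF assms that(2)]], symmetric]
      frechet_derivative_at[OF has_derivative_mult[OF smooth_at_has_derivative[OF assms that(1)]
          smooth_at_has_derivative[OF assms that(2)]], symmetric]
    by (simp_all add: coord_field_def o_def smooth_at_add smooth_at_mult)
  have "coord_field V c i q (\<lambda>x. a * f x) = a * coord_field V c i q f"
    if "smooth_at A q f" for a f
  proof -
    \<comment> \<open>Homogeneity is the product rule with a constant factor, whose derivative
      vanishes.\<close>
    have "coord_field V c i q (\<lambda>x. a) = 0"
      by (simp add: coord_field_def o_def)
    then show ?thesis
      using mult[OF smooth_at_const[of q a] that] by simp
  qed
  with add mult show ?thesis
    by (simp add: tangent_space_def coord_field_def)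
qed

text \<open>Seen in another chart, the coordinate derivative of \<open>f\<close> is a partial
  derivative of the expression of \<open>f\<close> in the first chart, composed with the smooth
  transition map.\<close>

lemma coord_field_vector_field:
  assumes V: "(V, c) \<in> A"
  shows "vector_field A V (coord_field V c i)"
  unfolding vector_field_def
proof safe
  fix W f assume W: "open W" "W \<subseteq> V" "smooth_fun A W f"
  show "smooth_fun A W (\<lambda>q. coord_field V c i q f)"
    unfolding smooth_fun_def
  proof clarify
    fix V' d assume V': "(V', d) \<in> A"
    let ?S = "d ` (W \<inter> V')" and ?t = "c \<circ> inv_into V' d"
    let ?F = "\<lambda>x. frechet_derivative (f \<circ> inv_into V c) (at x) (axis i 1)"
    have S: "open ?S"
      by (rule chart_image_open[OF V' W(1)])
    have "Cinf_on ?S ?t"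
      by (rule Cinf_on_subset[OF transition[OF V' V]]) (use W(2) in auto)
    moreover have "?t ` ?S \<subseteq> c ` (W \<inter> V)"
      using W(2) V' by auto
    moreover have "Cinf_on (c ` (W \<inter> V)) (f \<circ> inv_into V c)"
      using W(3) V unfolding smooth_fun_def by fast
    then have "Cinf_on (c ` (W \<inter> V)) ?F"
      by (rule Cinf_on_deriv)
    ultimately have "Cinf_on ?S (\<lambda>x. ?F (?t x))"
      by (rule_tac Cinf_on_compose[OF S])
    then show "Cinf_on ?S ((\<lambda>q. coord_field V c i q f) \<circ> inv_into V' d)"
      by (rule Cinf_on_cong[OF S, rotated])
        (use V' smooth_atI[OF W(1) _ W(3)] in \<open>auto simp: coord_field_def\<close>)
  qed
qed (rule coord_field_tangent[OF V])

lemma coord_field_coord: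
  assumes V: "(V, c) \<in> A" and q: "q \<in> V"
  shows "coord_field V c i q (\<lambda>x. c x $ j) = (if i = j then 1 else 0)"
proof -
  have "smooth_fun A V (\<lambda>x. c x $ j)"
    unfolding smooth_fun_def
  proof clarify
    fix V' d assume V': "(V', d) \<in> A"
    show "Cinf_on (d ` (V \<inter> V')) ((\<lambda>x. c x $ j) \<circ> inv_into V' d)"
      using Cinf_on_bounded_linear[OF bounded_linear_vec_nth[of j]
          chart_image_open[OF V' chart_open[OF V]], of "c \<circ> inv_into V' d"] transition[OF V' V]
      by (simp add: o_def Int_commute)
  qed
  then have sm: "smooth_at A q (\<lambda>x. c x $ j)"
    by (rule smooth_atI[OF chart_open[OF V] q])
  have o: "open (c ` V)"
    using chart_image_open[OF V open_UNIV] by simp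
  have "((\<lambda>x. x $ j) has_derivative (\<lambda>x. x $ j)) (at (c q))"
    by (rule bounded_linear_imp_has_derivative[OF bounded_linear_vec_nth])
  then have "(((\<lambda>x. c x $ j) \<circ> inv_into V c) has_derivative (\<lambda>x. x $ j)) (at (c q))"
    by (rule has_derivative_transform_within_open[OF _ o]) (use V q in auto)
  from frechet_derivative_at[OF this, symmetric] show ?thesis
    using sm by (simp add: coord_field_def axis_def)
qed

text \<open>The coordinate functions are dual to the coordinate fields, so applying a vanishing
  combination to the \<open>j\<close>-th coordinate isolates its \<open>j\<close>-th
  coefficient.\<close>

lemma coord_fields_independent:
  assumes V: "(V, c) \<in> A" and q: "q \<in> V"
  shows "distinct [coord_field V c 1 q, coord_field V c 2 q, coord_field V c 3 q] \<and>
    independent {coord_field V c 1 q, coord_field V c 2 q, coord_field V c 3 q}"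
proof (rule independent3I)
  fix a1 a2 a3 :: real
  assume "a1 *\<^sub>R coord_field V c 1 q + a2 *\<^sub>R coord_field V c 2 q + a3 *\<^sub>R coord_field V c 3 q = 0"
  then have "a1 * coord_field V c 1 q (\<lambda>x. c x $ j) + a2 * coord_field V c 2 q (\<lambda>x. c x $ j)
      + a3 * coord_field V c 3 q (\<lambda>x. c x $ j) = 0" for j
    by (auto simp: fun_eq_iff scaleR_fun_def)
  from this[of 1] this[of 2] this[of 3] show "a1 = 0 \<and> a2 = 0 \<and> a3 = 0"
    by (simp add: coord_field_coord[OF V q])
qed

text \<open>The metric provides three vectors spanning the tangent space, so independence suffices and
  Hadamard's lemma is not needed.\<close>

lemma coord_fields_span:
  assumes "(V, c) \<in> A" "q \<in> V" "tangent_space A q = span {e1, e2, e3}"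
  shows "span {coord_field V c 1 q, coord_field V c 2 q, coord_field V c 3 q} = tangent_space A q"
  unfolding assms(3)
proof (rule span_eq_of_independent_card)
  note d = coord_fields_independent[OF assms(1,2)]
  then show "independent {coord_field V c 1 q, coord_field V c 2 q, coord_field V c 3 q}"
    by simp
  show "{coord_field V c 1 q, coord_field V c 2 q, coord_field V c 3 q} \<subseteq> span {e1, e2, e3}"
    using coord_field_tangent[OF assms(1,2)] by (simp add: assms(3)[symmetric])
  have "card {coord_field V c 1 q, coord_field V c 2 q, coord_field V c 3 q} = 3"
    using d by simp
  then show "card {e1, e2, e3} \<le> card {coord_field V c 1 q, coord_field V c 2 q, coord_field V c 3 q}"
    by (simp add: card_insert_if)
qed simp

end


subsection \<open>Pointwise algebra of an almost paracontact metric structure\<close>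

locale paracontact3 = atlas3 A
  for A :: "'m::{t2_space, second_countable_topology} chart set" +
  fixes \<phi> :: "'m \<Rightarrow> 'm tangent \<Rightarrow> 'm tangent"
    and \<xi> :: "'m field"
    and \<eta> :: "'m \<Rightarrow> 'm tangent \<Rightarrow> real"
    and g :: "'m \<Rightarrow> 'm tangent \<Rightarrow> 'm tangent \<Rightarrow> real"
  assumes paracontact: "almost_paracontact_metric A \<phi> \<xi> \<eta> g"
begin

abbreviation T :: "'m \<Rightarrow> 'm tangent set" where "T q \<equiv> tangent_space A q"

lemma xi_field: "vector_field A U \<xi>"
  using paracontact vector_field_subset by (auto simp: almost_paracontact_metric_def)

lemma xi_tangent [simp]: "\<xi> q \<in> T q"
  using xi_field[of UNIV] by auto

lemma phi_tangent [simp]: "u \<in> T q \<Longrightarrow> \<phi> q u \<in> T q"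
  using paracontact unfolding almost_paracontact_metric_def tensor11_def by blast

lemma phi_field: "open U \<Longrightarrow> vector_field A U X \<Longrightarrow> vector_field A U (\<lambda>q. \<phi> q (X q))"
  using paracontact unfolding almost_paracontact_metric_def tensor11_def by blast

lemma phi_add: "u \<in> T q \<Longrightarrow> v \<in> T q \<Longrightarrow> \<phi> q (u + v) = \<phi> q u + \<phi> q v"
  and phi_scale: "u \<in> T q \<Longrightarrow> \<phi> q (a *\<^sub>R u) = a *\<^sub>R \<phi> q u"
  using paracontact unfolding almost_paracontact_metric_def tensor11_def linear_between_def
  by blast+

lemma phi_diff: "u \<in> T q \<Longrightarrow> v \<in> T q \<Longrightarrow> \<phi> q (u - v) = \<phi> q u - \<phi> q v"
  using phi_add[of u q "- v"] phi_scale[of v q "-1"] by simp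

lemma eta_add: "u \<in> T q \<Longrightarrow> v \<in> T q \<Longrightarrow> \<eta> q (u + v) = \<eta> q u + \<eta> q v"
  and eta_scale: "u \<in> T q \<Longrightarrow> \<eta> q (a *\<^sub>R u) = a * \<eta> q u"
  using paracontact unfolding almost_paracontact_metric_def one_form_def linear_between_def
  by (blast, metis real_scaleR_def)

lemma eta_xi [simp]: "\<eta> q (\<xi> q) = 1"
  using paracontact unfolding almost_paracontact_metric_def by blast

lemma phi_phi: "u \<in> T q \<Longrightarrow> \<phi> q (\<phi> q u) = u - \<eta> q u *\<^sub>R \<xi> q"
  using paracontact unfolding almost_paracontact_metric_def by blast

lemma g_phi_phi: "u \<in> T q \<Longrightarrow> v \<in> T q \<Longrightarrow> g q (\<phi> q u) (\<phi> q v) = - g q u v + \<eta> q u * \<eta> q v"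
  using paracontact unfolding almost_paracontact_metric_def by blast

lemma metric: "pseudo_riemannian_21 A g"
  using paracontact unfolding almost_paracontact_metric_def by blast

lemma g_smooth:
  "open U \<Longrightarrow> vector_field A U X \<Longrightarrow> vector_field A U Y \<Longrightarrow> smooth_fun A U (\<lambda>q. g q (X q) (Y q))"
  using metric unfolding pseudo_riemannian_21_def tensor02_def by blast

lemma g_sym: "u \<in> T q \<Longrightarrow> v \<in> T q \<Longrightarrow> g q u v = g q v u"
  using metric unfolding pseudo_riemannian_21_def by blast

lemma g_add_right: "u \<in> T q \<Longrightarrow> v \<in> T q \<Longrightarrow> w \<in> T q \<Longrightarrow> g q u (v + w) = g q u v + g q u w"
  and g_scale_right: "u \<in> T q \<Longrightarrow> v \<in> T q \<Longrightarrow> g q u (a *\<^sub>R v) = a * g q u v"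
  using metric unfolding pseudo_riemannian_21_def tensor02_def linear_between_def
  by (blast, metis real_scaleR_def)

lemma g_add_left: "u \<in> T q \<Longrightarrow> v \<in> T q \<Longrightarrow> w \<in> T q \<Longrightarrow> g q (v + w) u = g q v u + g q w u"
  and g_scale_left: "u \<in> T q \<Longrightarrow> v \<in> T q \<Longrightarrow> g q (a *\<^sub>R v) u = a * g q v u"
  using g_add_right[of u q v w] g_scale_right[of u q v a] by (simp_all add: g_sym[of _ q u])

lemma g_diff_left: "u \<in> T q \<Longrightarrow> v \<in> T q \<Longrightarrow> w \<in> T q \<Longrightarrow> g q (v - w) u = g q v u - g q w u"
  using g_add_left[of u q v "- w"] g_scale_left[of u q w "-1"] by simp

lemma g_zero: "u \<in> T q \<Longrightarrow> g q u 0 = 0" "u \<in> T q \<Longrightarrow> g q 0 u = 0"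
  using g_scale_right[of u q 0 0] g_scale_left[of u q 0 0] by simp_all

lemma tangent_space_eq_span: obtains e1 e2 e3 where "T q = span {e1, e2, e3}"
  using metric unfolding pseudo_riemannian_21_def by metis

text \<open>Pairing \<open>u\<close> with the pseudo-orthonormal basis recovers its coefficients up
  to sign.\<close>

lemma g_nondegenerate:
  assumes u: "u \<in> T q" and 0: "\<And>v. v \<in> T q \<Longrightarrow> g q u v = 0"
  shows "u = 0"
proof -
  obtain e1 e2 e3 where e: "span {e1, e2, e3} = T q"
    "g q e1 e1 = 1" "g q e2 e2 = 1" "g q e3 e3 = -1"
    "g q e1 e2 = 0" "g q e1 e3 = 0" "g q e2 e3 = 0"
    using metric unfolding pseudo_riemannian_21_def by metis
  have t: "e1 \<in> T q" "e2 \<in> T q" "e3 \<in> T q"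
    by (auto simp: e(1)[symmetric] intro: span_base)
  obtain a b c where abc: "u = a *\<^sub>R e1 + b *\<^sub>R e2 + c *\<^sub>R e3"
    using u e(1) span3E by metis
  have "g q u e1 = a" "g q u e2 = b" "g q u e3 = - c"
    using t e g_sym[of e2 q e1] g_sym[of e3 q e1] g_sym[of e3 q e2]
    by (simp_all add: abc g_add_left g_scale_left)
  then have "a = 0" "b = 0" "c = 0"
    using 0 t by simp_all
  then show ?thesis by (simp add: abc)
qed

section \<open>Algebraic identities for \<phi>, \<xi> and \<eta>\<close>

lemma xi_nonzero: "\<xi> q \<noteq> 0"
proof
  assume "\<xi> q = 0"
  moreover have "\<eta> q 0 = 0"
    using eta_scale[of 0 q 0] by simp
  ultimately show False
    using eta_xi[of q] by (simp del: eta_xi)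
qed

text \<open>For \<open>w = \<phi> \<xi>\<close> one has \<open>\<phi> w = 0\<close>, hence
  \<open>w = \<eta>(w) \<xi>\<close>. Applying \<phi> once more gives
  \<open>\<eta>(w) w = 0\<close>, and either factor being zero forces \<open>w = 0\<close>.\<close>

lemma phi_xi [simp]: "\<phi> q (\<xi> q) = 0"
proof -
  let ?w = "\<phi> q (\<xi> q)"
  have "\<phi> q ?w = 0"
    by (simp add: phi_phi)
  moreover have "\<phi> q 0 = 0"
    using phi_scale[of 0 q 0] by simp
  ultimately have w: "?w = \<eta> q ?w *\<^sub>R \<xi> q"
    using phi_phi[of ?w q] by simp
  then have "\<eta> q ?w *\<^sub>R ?w = 0"
    using \<open>\<phi> q ?w = 0\<close> phi_scale[of "\<xi> q" q "\<eta> q ?w"] by simp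
  then show ?thesis
    using w by auto
qed

text \<open>The triple application of \<phi> to \<open>u\<close> is computed in two ways, with the
  square of \<phi> taken outside or inside.\<close>

lemma eta_phi [simp]:
  assumes "u \<in> T q" shows "\<eta> q (\<phi> q u) = 0"
proof -
  have "\<phi> q u - \<eta> q (\<phi> q u) *\<^sub>R \<xi> q = \<phi> q (\<phi> q (\<phi> q u))"
    using phi_phi[of "\<phi> q u" q] assms by simp
  also have "\<dots> = \<phi> q (u - \<eta> q u *\<^sub>R \<xi> q)"
    by (simp only: phi_phi[OF assms])
  also have "\<dots> = \<phi> q u"
    using assms by (simp add: phi_diff phi_scale)
  finally show ?thesis
    using xi_nonzero by simp
qed

text \<open>Compatibility of \<open>g\<close> and \<phi> with \<xi> as second argument, where the
  left side vanishes: \<eta> is the metric dual of \<xi>.\<close>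

lemma g_xi [simp]:
  assumes "u \<in> T q" shows "g q u (\<xi> q) = \<eta> q u"
  using g_phi_phi[of u q "\<xi> q"] assms by (simp add: g_zero)

lemma g_xi' [simp]:
  assumes "u \<in> T q" shows "g q (\<xi> q) u = \<eta> q u"
  using g_sym[of "\<xi> q" q u] assms by simp

text \<open>Skewness of \<phi> is the compatibility condition with \<phi> applied to the first
  argument; the terms with \<eta> vanish because \<eta> kills the image of \<phi>.\<close>

lemma g_phi:
  assumes "u \<in> T q" "v \<in> T q"
  shows "g q (\<phi> q u) v = - g q u (\<phi> q v)"
  using g_phi_phi[of "\<phi> q u" q v] assms
  by (simp add: phi_phi g_diff_left g_scale_left)

lemma eigen_eta:
  assumes "u \<in> T q" "\<phi> q u = u \<or> \<phi> q u = - u"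
  shows "\<eta> q u = 0"
  using eta_phi[OF assms(1)] assms eta_scale[of u q "-1"] by (auto simp del: eta_phi)

text \<open>Equal eigenvalues 1 or -1 leave \<open>g u v\<close> unchanged under \<phi>, while
  compatibility on the kernel of \<eta> reverses its sign.\<close>

lemma eigen_isotropic:
  assumes "u \<in> T q" "v \<in> T q" "\<phi> q u = u \<and> \<phi> q v = v \<or> \<phi> q u = - u \<and> \<phi> q v = - v"
  shows "g q u v = 0"
proof -
  have "g q (- u) (- v) = g q u v"
    using assms g_scale_left[of "- v" q u "-1"] g_scale_right[of u q v "-1"] by simp
  then have "g q (\<phi> q u) (\<phi> q v) = g q u v"
    using assms(3) by auto
  moreover have "\<eta> q u = 0"
    using eigen_eta[OF assms(1)] assms(3) by auto
  ultimately show ?thesis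
    using g_phi_phi[OF assms(1,2)] by simp
qed

text \<open>Both eigenvectors are null and orthogonal to \<xi>, so the coefficient of
  \<open>u\<close> is read off by pairing with \<open>v\<close>, and conversely. This yields
  independence, and counting then yields the span.\<close>

lemma eigen_frame:
  assumes u: "u \<in> T q" "\<phi> q u = u" and v: "v \<in> T q" "\<phi> q v = - v" and r: "g q u v \<noteq> 0"
  shows eigen_frame_independent: "distinct [\<xi> q, u, v] \<and> independent {\<xi> q, u, v}"
    and eigen_frame_span: "span {\<xi> q, u, v} = T q"
    and eigen_frame_expand: "\<And>w. w \<in> T q \<Longrightarrow>
      w = \<eta> q w *\<^sub>R \<xi> q + (g q w v / g q u v) *\<^sub>R u + (g q w u / g q u v) *\<^sub>R v"
proof -
  have e: "\<eta> q u = 0" "\<eta> q v = 0" "g q u u = 0" "g q v v = 0"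
    using eigen_eta eigen_isotropic u v by blast+
  have co: "\<eta> q w = a" "g q w v = b * g q u v" "g q w u = c * g q u v"
    if "w = a *\<^sub>R \<xi> q + b *\<^sub>R u + c *\<^sub>R v" for w a b c
    using e u(1) v(1) g_sym[of v q u]
    by (simp_all add: that eta_add eta_scale g_add_left g_scale_left)
  show i: "distinct [\<xi> q, u, v] \<and> independent {\<xi> q, u, v}"
  proof (rule independent3I)
    fix a b c assume "a *\<^sub>R \<xi> q + b *\<^sub>R u + c *\<^sub>R v = 0"
    from co[OF this[symmetric]] show "a = 0 \<and> b = 0 \<and> c = 0"
      using r u v eta_scale[of 0 q 0] by (auto simp: g_zero)
  qed
  obtain e1 e2 e3 where T: "T q = span {e1, e2, e3}"
    by (rule tangent_space_eq_span)
  show s: "span {\<xi> q, u, v} = T q"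
    unfolding T
  proof (rule span_eq_of_independent_card)
    show "{\<xi> q, u, v} \<subseteq> span {e1, e2, e3}"
      using u v by (simp add: T[symmetric])
    have "card {\<xi> q, u, v} = 3"
      using i by simp
    then show "card {e1, e2, e3} \<le> card {\<xi> q, u, v}"
      by (simp add: card_insert_if)
  qed (use i in simp_all)
  fix w assume "w \<in> T q"
  then obtain a b c where w: "w = a *\<^sub>R \<xi> q + b *\<^sub>R u + c *\<^sub>R v"
    using span3E unfolding s[symmetric] by metis
  show "w = \<eta> q w *\<^sub>R \<xi> q + (g q w v / g q u v) *\<^sub>R u + (g q w u / g q u v) *\<^sub>R v"
    using co[OF w] w r by simp
qed

text \<open>The coordinate fields span the tangent space at \<open>q\<close>; if all of them were
  orthogonal to \<open>u\<close>, nondegeneracy would give \<open>u = 0\<close>.\<close>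

lemma local_field_pairing:
  assumes u: "u \<in> T q" "u \<noteq> 0"
  obtains V Y where "open V" "q \<in> V" "vector_field A V Y" "g q (Y q) u \<noteq> 0"
proof -
  obtain V c where V: "(V, c) \<in> A" "q \<in> V" by (rule chart_exists)
  obtain e1 e2 e3 where T: "T q = span {e1, e2, e3}"
    by (rule tangent_space_eq_span)
  let ?Y = "\<lambda>i. coord_field V c i q"
  have Y: "?Y i \<in> T q" for i
    by (rule coord_field_tangent[OF V])
  have "\<exists>i. g q (?Y i) u \<noteq> 0"
  proof (rule ccontr)
    assume "\<not> (\<exists>i. g q (?Y i) u \<noteq> 0)"
    then have 0: "g q u (?Y i) = 0" for i
      using g_sym[OF u(1) Y] by simp
    have "g q u v = 0" if "v \<in> T q" for v
    proof -
      have "v \<in> span {?Y 1, ?Y 2, ?Y 3}"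
        using that coord_fields_span[OF V T] by simp
      then obtain a b c' where "v = a *\<^sub>R ?Y 1 + b *\<^sub>R ?Y 2 + c' *\<^sub>R ?Y 3"
        by (rule span3E)
      then show ?thesis
        using u(1) Y 0 by (simp add: g_add_right g_scale_right)
    qed
    then show False
      using g_nondegenerate u by blast
  qed
  then show ?thesis
    using that[OF chart_open[OF V(1)] V(2) coord_field_vector_field[OF V(1)]] by blast
qed

end


subsection \<open>The Levi-Civita connection and the tensor h\<close>

locale paracosymplectic3 = paracontact3 A \<phi> \<xi> \<eta> g
  for A :: "'m::{t2_space, second_countable_topology} chart set"
    and \<phi> :: "'m \<Rightarrow> 'm tangent \<Rightarrow> 'm tangent"
    and \<xi> :: "'m field"
    and \<eta> :: "'m \<Rightarrow> 'm tangent \<Rightarrow> real"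
    and g :: "'m \<Rightarrow> 'm tangent \<Rightarrow> 'm tangent \<Rightarrow> real" +
  fixes D :: "'m field \<Rightarrow> 'm field \<Rightarrow> 'm field"
  assumes almost_paracosymplectic: "almost_paracosymplectic A \<phi> \<xi> \<eta> g"
    and levi_civita: "levi_civita A g D"
begin

lemma connection: "affine_connection A D"
  using levi_civita unfolding levi_civita_def by blast

lemma D_field:
  assumes "open U" "vector_field A U X" "vector_field A U Y"
  shows "vector_field A U (D X Y)"
  using connection assms smooth_fun_const[OF assms(1), of 0]
  unfolding affine_connection_def by blast

lemma D_tangent:
  assumes "open U" "vector_field A U X" "vector_field A U Y" "q \<in> U"
  shows "D X Y q \<in> T q"
  using D_field[OF assms(1-3)] assms(4) by auto

lemma D_add_left:
  assumes "open U" "vector_field A U X" "vector_field A U X'" "vector_field A U Y" "q \<in> U"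
  shows "D (X + X') Y q = D X Y q + D X' Y q"
  using connection assms smooth_fun_const[OF assms(1), of 0]
  unfolding affine_connection_def by blast

lemma D_add_right:
  assumes "open U" "vector_field A U X" "vector_field A U Y" "vector_field A U Y'" "q \<in> U"
  shows "D X (Y + Y') q = D X Y q + D X Y' q"
  using connection assms smooth_fun_const[OF assms(1), of 0]
  unfolding affine_connection_def by blast

lemma D_fmult_left:
  assumes "open U" "vector_field A U X" "vector_field A U Y" "smooth_fun A U f" "q \<in> U"
  shows "D (fmult f X) Y q = f q *\<^sub>R D X Y q"
  using connection assms unfolding affine_connection_def by blast

lemma D_fmult_right:
  assumes "open U" "vector_field A U X" "vector_field A U Y" "smooth_fun A U f" "q \<in> U"
  shows "D X (fmult f Y) q = X q f *\<^sub>R Y q + f q *\<^sub>R D X Y q"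
  using connection assms unfolding affine_connection_def by blast

lemma D_scale_right:
  assumes "open U" "vector_field A U X" "vector_field A U Y" "q \<in> U"
  shows "D X (fmult (\<lambda>_. a) Y) q = a *\<^sub>R D X Y q"
proof -
  have "X q (\<lambda>_. a) = 0"
    using assms tangent_const by blast
  then show ?thesis
    using D_fmult_right[OF assms(1-3) smooth_fun_const[OF assms(1)] assms(4)] by simp
qed

lemma bracket_eq:
  assumes "open U" "vector_field A U X" "vector_field A U Y" "q \<in> U"
  shows "lie_bracket A X Y q = D X Y q - D Y X q"
  using levi_civita assms unfolding levi_civita_def by metis

lemma D_metric:
  assumes "open U" "vector_field A U X" "vector_field A U Y" "vector_field A U Z" "q \<in> U"
  shows "X q (\<lambda>q. g q (Y q) (Z q)) = g q (D X Y q) (Z q) + g q (Y q) (D X Z q)"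
  using levi_civita assms unfolding levi_civita_def by blast

text \<open>Locality uses once more that smooth functions are unconstrained off \<open>U\<close>: a field that
  vanishes on \<open>U\<close> is its own multiple by a function vanishing on \<open>U\<close>.\<close>

lemma vanishing_field_multiple:
  assumes "open U" "\<And>q. q \<in> U \<Longrightarrow> Z q = 0"
  obtains f where "smooth_fun A U f" "\<And>q. q \<in> U \<Longrightarrow> f q = 0" "fmult f Z = Z"
proof
  let ?f = "\<lambda>q. if q \<in> U then 0 else (1::real)"
  show "smooth_fun A U ?f"
    by (rule smooth_fun_cong[OF assms(1) _ smooth_fun_const[OF assms(1), of 0]]) simp
  show "fmult ?f Z = Z"
    using assms(2) by (auto simp: fmult_def fun_eq_iff scaleR_fun_def)
qed simp

lemma D_cong:
  assumes U: "open U" "q \<in> U" and X: "vector_field A U X" and Y: "vector_field A U Y"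
    and X': "\<And>q. q \<in> U \<Longrightarrow> X q = X' q" and Y': "\<And>q. q \<in> U \<Longrightarrow> Y q = Y' q"
  shows "D X Y q = D X' Y' q"
proof -
  have fX': "vector_field A U X'" and fY': "vector_field A U Y'"
    using vector_field_cong X Y X' Y' by blast+
  note ZX = vector_field_diff[OF U(1) X fX'] and ZY = vector_field_diff[OF U(1) Y fY']
  obtain f where f: "smooth_fun A U f" "f q = 0" "fmult f (X - X') = X - X'"
    using vanishing_field_multiple[OF U(1), of "X - X'"] X' U(2)
    by (metis fun_diff_def right_minus_eq)
  have "D (X - X') Y q = 0"
    using D_fmult_left[OF U(1) ZX Y f(1) U(2)] f by simp
  moreover
  obtain f where f: "smooth_fun A U f" "f q = 0" "fmult f (Y - Y') = Y - Y'"
    using vanishing_field_multiple[OF U(1), of "Y - Y'"] Y' U(2)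
    by (metis fun_diff_def right_minus_eq)
  \<comment> \<open>The Leibniz rule leaves a derivative of \<open>f\<close> times
    \<open>(Y - Y') q\<close> and \<open>f q\<close> times a covariant derivative;
    \<open>(Y - Y') q\<close> and \<open>f q\<close> are both zero.\<close>
  have "D X' (Y - Y') q = 0"
    using D_fmult_right[OF U(1) fX' ZY f(1) U(2)] f Y'[OF U(2)] by simp
  ultimately show ?thesis
    using D_add_left[OF U(1) ZX fX' Y U(2)] D_add_right[OF U(1) fX' ZY fY' U(2)] by simp
qed

text \<open>Vanishing torsion makes the bracket a difference of covariant derivatives, so its
  locality, and below its smoothness, are inherited from \<open>D\<close>.\<close>

lemma bracket_cong:
  assumes U: "open U" "q \<in> U" and X: "vector_field A U X" and Y: "vector_field A U Y"
    and X': "\<And>q. q \<in> U \<Longrightarrow> X q = X' q" and Y': "\<And>q. q \<in> U \<Longrightarrow> Y q = Y' q"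
  shows "lie_bracket A X Y q = lie_bracket A X' Y' q"
proof -
  have "vector_field A U X'" "vector_field A U Y'"
    using vector_field_cong X Y X' Y' by blast+
  then show ?thesis
    using D_cong[OF assms] D_cong[OF U Y X Y' X'] U X Y by (simp add: bracket_eq)
qed

lemma bracket_field:
  assumes "open U" "vector_field A U X" "vector_field A U Y"
  shows "vector_field A U (lie_bracket A X Y)"
  by (rule vector_field_cong[OF vector_field_diff[OF assms(1) D_field[OF assms] D_field[OF assms(1,3,2)]]])
    (simp add: bracket_eq[OF assms])

section \<open>The tensor \<open>h\<close> and the closed form \<eta>\<close>

lemma h_field:
  assumes "open U" "vector_field A U X"
  shows "vector_field A U (h_tensor A \<phi> \<xi> X)"
proof (rule vector_field_cong)
  show "vector_field A U (fmult (\<lambda>_. 1/2)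
      (lie_bracket A \<xi> (\<lambda>q. \<phi> q (X q)) - (\<lambda>q. \<phi> q (lie_bracket A \<xi> X q))))"
    using assms
    by (intro vector_field_scale vector_field_diff bracket_field phi_field xi_field)
qed (simp add: fmult_def h_tensor_def lie_deriv11_def)

lemma h_cong:
  assumes U: "open U" "q \<in> U" and X: "vector_field A U X" and X': "\<And>q. q \<in> U \<Longrightarrow> X q = X' q"
  shows "h_tensor A \<phi> \<xi> X q = h_tensor A \<phi> \<xi> X' q"
proof -
  have "lie_bracket A \<xi> X q = lie_bracket A \<xi> X' q"
    by (rule bracket_cong[OF U xi_field X refl X'])
  moreover have "lie_bracket A \<xi> (\<lambda>q. \<phi> q (X q)) q = lie_bracket A \<xi> (\<lambda>q. \<phi> q (X' q)) q"
    by (rule bracket_cong[OF U xi_field phi_field[OF U(1) X] refl]) (simp add: X')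
  ultimately show ?thesis
    by (simp add: h_tensor_def lie_deriv11_def)
qed

text \<open>Both brackets in the Lie derivative produce the term \<open>\<xi>(f) \<phi> X\<close>,
  with opposite signs, so only the multiple by \<open>f\<close> survives.\<close>

lemma h_fmult:
  assumes U: "open U" "q \<in> U" and X: "vector_field A U X" and f: "smooth_fun A U f"
  shows "h_tensor A \<phi> \<xi> (fmult f X) q = f q *\<^sub>R h_tensor A \<phi> \<xi> X q"
proof -
  have b: "lie_bracket A \<xi> (fmult f Y) q = \<xi> q f *\<^sub>R Y q + f q *\<^sub>R lie_bracket A \<xi> Y q"
    if Y: "vector_field A U Y" for Y
    using D_fmult_right[OF U(1) xi_field Y f U(2)] D_fmult_left[OF U(1) Y xi_field f U(2)]
    by (simp add: bracket_eq[OF U(1) xi_field _ U(2)] Y vector_field_fmult f scaleR_diff_right)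
  note pX = phi_field[OF U(1) X]
  have "lie_bracket A \<xi> (\<lambda>q. \<phi> q (fmult f X q)) q = lie_bracket A \<xi> (fmult f (\<lambda>q. \<phi> q (X q))) q"
    by (rule bracket_cong[OF U xi_field phi_field[OF U(1) vector_field_fmult[OF X f]] refl])
      (use X in \<open>simp add: fmult_def phi_scale vector_field_tangent\<close>)
  moreover have "\<phi> q (lie_bracket A \<xi> (fmult f X) q)
      = \<xi> q f *\<^sub>R \<phi> q (X q) + f q *\<^sub>R \<phi> q (lie_bracket A \<xi> X q)"
    using vector_field_tangent[OF X U(2)]
      vector_field_tangent[OF bracket_field[OF U(1) xi_field X] U(2)]
    by (simp add: b[OF X] phi_add phi_scale)
  ultimately show ?thesis
    by (simp add: h_tensor_def lie_deriv11_def b[OF pX] scaleR_diff_right algebra_simps)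
qed

text \<open>Closedness of \<eta> with both derivative terms zero; the constants will be 1 for \<xi>
  and 0 for eigenfields of \<phi>.\<close>

lemma eta_bracket:
  assumes U: "open U" "q \<in> U" and X: "vector_field A U X" and Y: "vector_field A U Y"
    and a: "\<And>q. q \<in> U \<Longrightarrow> \<eta> q (X q) = a" and b: "\<And>q. q \<in> U \<Longrightarrow> \<eta> q (Y q) = b"
  shows "\<eta> q (lie_bracket A X Y q) = 0"
proof -
  have "ext_deriv1 A \<eta> X Y q = 0"
    using almost_paracosymplectic U X Y unfolding almost_paracosymplectic_def by blast
  moreover have "X q (\<lambda>q. \<eta> q (Y q)) = 0" "Y q (\<lambda>q. \<eta> q (X q)) = 0"
    using tangent_local[OF vector_field_tangent[OF X U(2)] U, of "\<lambda>q. \<eta> q (Y q)" "\<lambda>_. b"]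
      tangent_local[OF vector_field_tangent[OF Y U(2)] U, of "\<lambda>q. \<eta> q (X q)" "\<lambda>_. a"]
      tangent_const vector_field_tangent[OF X U(2)] vector_field_tangent[OF Y U(2)] a b
    by simp_all
  ultimately show ?thesis
    by (simp add: ext_deriv1_def)
qed

text \<open>With \<open>B\<close> the bracket of \<xi> and \<open>X\<close>, the value of
  \<open>h\<close> is half of \<open>B - \<phi> B\<close>. Since \<eta> kills \<open>B\<close>,
  \<phi> squares to the identity on \<open>B\<close> and reverses this difference.\<close>

lemma phi_h:
  assumes U: "open U" "q \<in> U" and X: "vector_field A U X" and e: "\<And>q. q \<in> U \<Longrightarrow> \<phi> q (X q) = X q"
  shows h_eigen: "h_tensor A \<phi> \<xi> X q
      = (1/2) *\<^sub>R (lie_bracket A \<xi> X q - \<phi> q (lie_bracket A \<xi> X q))"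
    and "\<phi> q (h_tensor A \<phi> \<xi> X q) = - h_tensor A \<phi> \<xi> X q"
proof -
  let ?B = "lie_bracket A \<xi> X q"
  have B: "?B \<in> T q"
    by (rule vector_field_tangent[OF bracket_field[OF U(1) xi_field X] U(2)])
  have "lie_bracket A \<xi> (\<lambda>q. \<phi> q (X q)) q = ?B"
    by (rule bracket_cong[OF U xi_field phi_field[OF U(1) X] refl]) (rule e)
  then show h: "h_tensor A \<phi> \<xi> X q = (1/2) *\<^sub>R (?B - \<phi> q ?B)"
    by (simp add: h_tensor_def lie_deriv11_def)
  have "\<eta> q ?B = 0"
    by (rule eta_bracket[OF U xi_field X eta_xi, of 0])
      (use X e eigen_eta in blast)
  then show "\<phi> q (h_tensor A \<phi> \<xi> X q) = - h_tensor A \<phi> \<xi> X q"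
    using B by (simp add: h phi_scale phi_diff phi_phi algebra_simps)
qed

text \<open>In an eigenframe \<open>(\<xi>, Y', hX)\<close> near \<open>q\<close> with \<open>\<phi> Y' = Y'\<close> the field \<open>X\<close> is a function times
  \<open>Y'\<close>; if that function vanished at \<open>q\<close>, so would \<open>hX\<close> by tensoriality.\<close>

lemma g_h_nonzero:
  assumes U: "open U" "q \<in> U" and X: "vector_field A U X" and e: "\<And>q. q \<in> U \<Longrightarrow> \<phi> q (X q) = X q"
    and h: "h_tensor A \<phi> \<xi> X q \<noteq> 0"
  shows "g q (X q) (h_tensor A \<phi> \<xi> X q) \<noteq> 0"
proof
  let ?W = "h_tensor A \<phi> \<xi> X"
  assume 0: "g q (X q) (?W q) = 0"
  note W = h_field[OF U(1) X]
  obtain V Y where V: "open V" "q \<in> V" "vector_field A V Y" "g q (Y q) (?W q) \<noteq> 0"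
    using local_field_pairing[OF vector_field_tangent[OF W U(2)] h] by metis
  \<comment> \<open>The cube of \<phi> is \<phi>, so this sum is fixed by \<phi>; it is twice the
    projection of \<open>Y\<close> to the eigenvalue 1. Skewness of \<phi> makes its pairing with
    \<open>?W q\<close> twice that of \<open>Y\<close>.\<close>
  define Y' where "Y' = (\<lambda>q. \<phi> q (Y q)) + (\<lambda>q. \<phi> q (\<phi> q (Y q)))"
  have Y': "vector_field A V Y'"
    unfolding Y'_def using V by (intro vector_field_add phi_field)
  have eY': "\<phi> x (Y' x) = Y' x" if "x \<in> V" for x
    using vector_field_tangent[OF V(3) that]
    by (simp add: Y'_def phi_add phi_phi[of "\<phi> x (Y x)"] add.commute)
  define r where "r = (\<lambda>x. g x (Y' x) (?W x))"
  have "r q = 2 * g q (Y q) (?W q)"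
    unfolding r_def Y'_def
    using vector_field_tangent[OF V(3,2)] vector_field_tangent[OF W U(2)] phi_h(2)[OF U X e]
      g_scale_right[of "Y q" q "?W q" "-1"] g_scale_right[of "\<phi> q (Y q)" q "?W q" "-1"]
    by (simp add: g_add_left g_phi)
  then have rq: "r q \<noteq> 0" using V by simp
  have rs: "smooth_fun A (U \<inter> V) r"
    unfolding r_def using U V W Y'
    by (intro g_smooth) (auto intro: vector_field_subset)
  define N where "N = {x \<in> U \<inter> V. r x * r x > 0}"
  have N: "open N"
    unfolding N_def using U V rs by (intro smooth_fun_open_pos smooth_fun_mult) auto
  have N': "q \<in> N" "N \<subseteq> U" "N \<subseteq> V"
    using U V rq by (auto simp: N_def zero_less_mult_iff linorder_neq_iff)
  have rN: "r x \<noteq> 0" if "x \<in> N" for x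
    using that by (auto simp: N_def)
  define f where "f = (\<lambda>x. g x (X x) (?W x) * inverse (r x))"
  note sub = vector_field_subset[OF X N'(2)] vector_field_subset[OF W N'(2)]
    vector_field_subset[OF Y' N'(3)]
  have f: "smooth_fun A N f"
    unfolding f_def using rN smooth_fun_subset[OF rs, of N] N'
    by (intro smooth_fun_mult smooth_fun_inverse N g_smooth sub) auto
  \<comment> \<open>In the expansion along \<xi>, \<open>Y'\<close> and \<open>?W\<close> the
    coefficients of \<xi> and \<open>?W\<close> are zero, because \<open>X\<close> and
    \<open>Y'\<close> lie in the same eigenspace.\<close>
  have "X x = fmult f Y' x" if x: "x \<in> N" for x
  proof -
    have t: "X x \<in> T x" "Y' x \<in> T x" "?W x \<in> T x"
      using sub x by auto
    have p: "\<phi> x (X x) = X x" "\<phi> x (Y' x) = Y' x" "\<phi> x (?W x) = - ?W x"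
      using x N' e eY' phi_h(2)[OF U(1) _ X e] by auto
    have "g x (Y' x) (?W x) \<noteq> 0"
      using rN[OF x] by (simp add: r_def)
    from eigen_frame_expand[OF t(2) p(2) t(3) p(3) this t(1)]
    show ?thesis
      using eigen_eta[OF t(1)] eigen_isotropic[OF t(1,2)] p
      by (simp add: fmult_def f_def r_def divide_inverse)
  qed
  then have "?W q = f q *\<^sub>R h_tensor A \<phi> \<xi> Y' q"
    using h_cong[OF N N'(1) sub(1)] h_fmult[OF N N'(1) sub(3) f] by metis
  then show False
    using h 0 by (simp add: f_def)
qed

end


subsection \<open>Frames adapted to h on a (kappa, mu)-space\<close>

text \<open>The condition on \<open>\<epsilon>\<close> encodes a sign. The frame is kept abstract
  here; rescaling \<open>X\<close> and its image under \<open>h\<close> provides it in the final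
  theorem.\<close>

locale h_frame = paracosymplectic3 A \<phi> \<xi> \<eta> g D
  for A :: "'m::{t2_space, second_countable_topology} chart set"
    and \<phi> :: "'m \<Rightarrow> 'm tangent \<Rightarrow> 'm tangent"
    and \<xi> :: "'m field"
    and \<eta> :: "'m \<Rightarrow> 'm tangent \<Rightarrow> real"
    and g :: "'m \<Rightarrow> 'm tangent \<Rightarrow> 'm tangent \<Rightarrow> real"
    and D :: "'m field \<Rightarrow> 'm field \<Rightarrow> 'm field" +
  fixes \<kappa> \<mu> \<epsilon> :: real and V :: "'m set" and E\<^sub>1 E\<^sub>2 :: "'m field"
  assumes kappa_mu: "kappa_mu_space A \<phi> \<xi> \<eta> D \<kappa> \<mu>"
    and open_V: "open V"
    and E1_field: "vector_field A V E\<^sub>1"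
    and E2_field: "vector_field A V E\<^sub>2"
    and phi_E1: "q \<in> V \<Longrightarrow> \<phi> q (E\<^sub>1 q) = E\<^sub>1 q"
    and phi_E2: "q \<in> V \<Longrightarrow> \<phi> q (E\<^sub>2 q) = - E\<^sub>2 q"
    and g_E1_E2: "q \<in> V \<Longrightarrow> g q (E\<^sub>1 q) (E\<^sub>2 q) = 1"
    and h_E1: "q \<in> V \<Longrightarrow> h_tensor A \<phi> \<xi> E\<^sub>1 q = \<epsilon> *\<^sub>R E\<^sub>2 q"
    and eps_square: "\<epsilon> * \<epsilon> = 1"
begin

section \<open>Covariant derivatives in the adapted frame\<close>

lemmas frame_fields = open_V xi_field E1_field E2_field

lemma E_tangent [simp]: "q \<in> V \<Longrightarrow> E\<^sub>1 q \<in> T q" "q \<in> V \<Longrightarrow> E\<^sub>2 q \<in> T q"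
  using E1_field E2_field by auto

lemma gram [simp]:
  assumes "q \<in> V"
  shows "\<eta> q (E\<^sub>1 q) = 0" "\<eta> q (E\<^sub>2 q) = 0" "g q (E\<^sub>1 q) (E\<^sub>1 q) = 0" "g q (E\<^sub>2 q) (E\<^sub>2 q) = 0"
    "g q (E\<^sub>1 q) (E\<^sub>2 q) = 1" "g q (E\<^sub>2 q) (E\<^sub>1 q) = 1"
  using assms phi_E1 phi_E2 g_E1_E2 eigen_eta eigen_isotropic g_sym[of "E\<^sub>2 q" q "E\<^sub>1 q"]
  by simp_all

lemma artin: "artin_frame A \<phi> \<xi> g V E\<^sub>1 E\<^sub>2"
proof -
  have "distinct [\<xi> q, E\<^sub>1 q, E\<^sub>2 q] \<and> independent {\<xi> q, E\<^sub>1 q, E\<^sub>2 q}"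
    "span {\<xi> q, E\<^sub>1 q, E\<^sub>2 q} = T q" if "q \<in> V" for q
    using that phi_E1 phi_E2
    by (intro eigen_frame_independent eigen_frame_span; simp)+
  then show ?thesis
    unfolding artin_frame_def local_frame_def
    using frame_fields phi_E1 phi_E2 by simp
qed

lemma expand:
  assumes "q \<in> V" "w \<in> T q"
  shows "w = \<eta> q w *\<^sub>R \<xi> q + g q w (E\<^sub>2 q) *\<^sub>R E\<^sub>1 q + g q w (E\<^sub>1 q) *\<^sub>R E\<^sub>2 q"
  using eigen_frame_expand[of "E\<^sub>1 q" q "E\<^sub>2 q" w] assms phi_E1 phi_E2 by simp

lemma frame_coeff:
  assumes "q \<in> V" "a *\<^sub>R E\<^sub>1 q + b *\<^sub>R E\<^sub>2 q = a' *\<^sub>R E\<^sub>1 q + b' *\<^sub>R E\<^sub>2 q"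
  shows "a = a'" "b = b'"
proof -
  have "g q (a *\<^sub>R E\<^sub>1 q + b *\<^sub>R E\<^sub>2 q) u = g q (a' *\<^sub>R E\<^sub>1 q + b' *\<^sub>R E\<^sub>2 q) u" for u
    by (simp only: assms(2))
  from this[of "E\<^sub>2 q"] this[of "E\<^sub>1 q"] show "a = a'" "b = b'"
    using assms(1) by (simp_all add: g_add_left g_scale_left)
qed

text \<open>The derivative of a constant inner product is zero, so metric compatibility reduces to
  skewness. Locality of derivations enters since constancy is known on \<open>V\<close>
  only.\<close>

lemma metric_const:
  assumes X: "vector_field A V X" and Y: "vector_field A V Y" and Z: "vector_field A V Z"
    and a: "\<And>q. q \<in> V \<Longrightarrow> g q (Y q) (Z q) = a" and q: "q \<in> V"
  shows "g q (D X Y q) (Z q) = - g q (D X Z q) (Y q)"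
proof -
  have "X q (\<lambda>q. g q (Y q) (Z q)) = 0"
    using tangent_local[OF vector_field_tangent[OF X q] open_V q, of _ "\<lambda>_. a"] a
      tangent_const[OF vector_field_tangent[OF X q]] by metis
  moreover have "g q (Y q) (D X Z q) = g q (D X Z q) (Y q)"
    using g_sym vector_field_tangent[OF Y q] D_tangent[OF open_V X Z q] by blast
  ultimately show ?thesis
    using D_metric[OF open_V X Y Z q] by simp
qed

text \<open>The Gram matrix of the frame is constant, so the connection is skew and each direction
  \<open>X\<close> leaves three coefficients free.\<close>

lemma D_expand:
  assumes X: "vector_field A V X" and q: "q \<in> V"
  shows "D X \<xi> q = g q (D X \<xi> q) (E\<^sub>2 q) *\<^sub>R E\<^sub>1 q + g q (D X \<xi> q) (E\<^sub>1 q) *\<^sub>R E\<^sub>2 q"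
    and "D X E\<^sub>1 q = - g q (D X \<xi> q) (E\<^sub>1 q) *\<^sub>R \<xi> q + g q (D X E\<^sub>1 q) (E\<^sub>2 q) *\<^sub>R E\<^sub>1 q"
    and "D X E\<^sub>2 q = - g q (D X \<xi> q) (E\<^sub>2 q) *\<^sub>R \<xi> q - g q (D X E\<^sub>1 q) (E\<^sub>2 q) *\<^sub>R E\<^sub>2 q"
proof -
  note t = D_tangent[OF open_V X _ q]
  note c = metric_const[OF X _ _ _ q]
  have "\<eta> q (D X \<xi> q) = 0"
    using c[OF xi_field xi_field, of 1] t[OF xi_field] by simp
  then show "D X \<xi> q = g q (D X \<xi> q) (E\<^sub>2 q) *\<^sub>R E\<^sub>1 q + g q (D X \<xi> q) (E\<^sub>1 q) *\<^sub>R E\<^sub>2 q"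
    using expand[OF q t[OF xi_field]] by simp
  have "\<eta> q (D X E\<^sub>1 q) = - g q (D X \<xi> q) (E\<^sub>1 q)" "g q (D X E\<^sub>1 q) (E\<^sub>1 q) = 0"
    using c[OF E1_field xi_field, of 0] c[OF E1_field E1_field, of 0] t[OF E1_field] by simp_all
  then show "D X E\<^sub>1 q = - g q (D X \<xi> q) (E\<^sub>1 q) *\<^sub>R \<xi> q + g q (D X E\<^sub>1 q) (E\<^sub>2 q) *\<^sub>R E\<^sub>1 q"
    using expand[OF q t[OF E1_field]] by simp
  have "\<eta> q (D X E\<^sub>2 q) = - g q (D X \<xi> q) (E\<^sub>2 q)" "g q (D X E\<^sub>2 q) (E\<^sub>2 q) = 0"
    "g q (D X E\<^sub>2 q) (E\<^sub>1 q) = - g q (D X E\<^sub>1 q) (E\<^sub>2 q)"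
    using c[OF E2_field xi_field, of 0] c[OF E2_field E2_field, of 0] c[OF E2_field E1_field, of 1]
      t[OF E2_field] by simp_all
  then show "D X E\<^sub>2 q = - g q (D X \<xi> q) (E\<^sub>2 q) *\<^sub>R \<xi> q - g q (D X E\<^sub>1 q) (E\<^sub>2 q) *\<^sub>R E\<^sub>2 q"
    using expand[OF q t[OF E2_field]] by simp
qed

text \<open>Closedness of \<eta> kills the \<xi>-component of the bracket; moving the derivative
  onto \<xi> shows that the covariant derivative of \<xi> is self-adjoint.\<close>

lemma D_xi_symmetric:
  assumes X: "vector_field A V X" and Y: "vector_field A V Y" and q: "q \<in> V"
    and a: "\<And>q. q \<in> V \<Longrightarrow> \<eta> q (X q) = a" and b: "\<And>q. q \<in> V \<Longrightarrow> \<eta> q (Y q) = b"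
  shows "g q (D X \<xi> q) (Y q) = g q (D Y \<xi> q) (X q)"
proof -
  note tX = D_tangent[OF open_V X Y q] and tY = D_tangent[OF open_V Y X q]
  have "0 = \<eta> q (D X Y q - D Y X q)"
    using eta_bracket[OF open_V q X Y a b] bracket_eq[OF open_V X Y q] by simp
  also have "\<dots> = g q (D X Y q - D Y X q) (\<xi> q)"
    using tX tY by simp
  also have "\<dots> = g q (D X Y q) (\<xi> q) - g q (D Y X q) (\<xi> q)"
    using tX tY by (simp only: g_diff_left xi_tangent)
  also have "\<dots> = - g q (D X \<xi> q) (Y q) + g q (D Y \<xi> q) (X q)"
    using metric_const[OF X Y xi_field, of b] metric_const[OF Y X xi_field, of a] q a b
      vector_field_tangent[OF X] vector_field_tangent[OF Y] by simp
  finally show ?thesis by simp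
qed

text \<open>\<open>d\<Phi> = 0\<close> says that \<open>\<xi>\<close> is divergence free.\<close>

lemma xi_divergence_free:
  assumes q: "q \<in> V"
  shows "g q (D E\<^sub>1 \<xi> q) (E\<^sub>2 q) + g q (D E\<^sub>2 \<xi> q) (E\<^sub>1 q) = 0"
proof -
  let ?F = "fundamental_form \<phi> g"
  have F: "?F x u (\<xi> x) = 0" "?F x u (E\<^sub>1 x) = g x u (E\<^sub>1 x)" "?F x u (E\<^sub>2 x) = - g x u (E\<^sub>2 x)"
    if "x \<in> V" "u \<in> T x" for x u
    using that phi_E1 phi_E2 g_scale_right[of u x "E\<^sub>2 x" "-1"]
    by (simp_all add: fundamental_form_def g_zero)
  \<comment> \<open>On frame fields the fundamental form is constant, so all three derivative terms
    vanish. The term with the bracket of \<open>E\<^sub>1\<close> and \<open>E\<^sub>2\<close>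
    vanishes too, as \<xi> is in its kernel.\<close>
  have "\<xi> q (\<lambda>x. ?F x (E\<^sub>1 x) (E\<^sub>2 x)) = 0"
    using tangent_local[OF xi_tangent open_V q, of "\<lambda>x. ?F x (E\<^sub>1 x) (E\<^sub>2 x)" "\<lambda>_. -1"]
      tangent_const[OF xi_tangent] by (simp add: F)
  moreover have "E\<^sub>1 q (\<lambda>x. ?F x (E\<^sub>2 x) (\<xi> x)) = 0"
    using tangent_local[OF E_tangent(1)[OF q] open_V q, of "\<lambda>x. ?F x (E\<^sub>2 x) (\<xi> x)" "\<lambda>_. 0"]
      tangent_const[OF E_tangent(1)[OF q]] by (simp add: F)
  moreover have "E\<^sub>2 q (\<lambda>x. ?F x (\<xi> x) (E\<^sub>1 x)) = 0"
    using tangent_local[OF E_tangent(2)[OF q] open_V q, of "\<lambda>x. ?F x (\<xi> x) (E\<^sub>1 x)" "\<lambda>_. 0"]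
      tangent_const[OF E_tangent(2)[OF q]] by (simp add: F)
  moreover have "ext_deriv2 A ?F \<xi> E\<^sub>1 E\<^sub>2 q = 0"
    using almost_paracosymplectic frame_fields q unfolding almost_paracosymplectic_def by blast
  moreover note t = bracket_field[OF open_V, THEN vector_field_tangent, OF _ _ q]
  ultimately have "g q (lie_bracket A \<xi> E\<^sub>1 q) (E\<^sub>2 q) - g q (lie_bracket A E\<^sub>2 \<xi> q) (E\<^sub>1 q) = 0"
    using t[OF xi_field E1_field] t[OF E1_field E2_field] t[OF E2_field xi_field] q
    by (simp add: ext_deriv2_def F)
  \<comment> \<open>Once the brackets are expanded, the two derivatives along \<xi> cancel by
    skewness.\<close>
  then show ?thesis
    using metric_const[OF xi_field E1_field E2_field g_E1_E2 q] q
      D_tangent[OF open_V xi_field E1_field q] D_tangent[OF open_V E1_field xi_field q]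
      D_tangent[OF open_V xi_field E2_field q] D_tangent[OF open_V E2_field xi_field q]
    by (simp add: bracket_eq[OF open_V _ _ q] frame_fields g_diff_left)
qed

text \<open>Skewness of \<phi> turns \<open>g(h E\<^sub>1, E\<^sub>1)\<close> into minus the
  \<open>E\<^sub>2\<close> coefficient. The \<open>E\<^sub>1\<close> coefficient equals its
  counterpart for \<open>E\<^sub>2\<close> by symmetry and is opposite to it by zero
  divergence.\<close>

lemma D_E1_xi:
  assumes q: "q \<in> V" shows "D E\<^sub>1 \<xi> q = - \<epsilon> *\<^sub>R E\<^sub>2 q"
proof -
  let ?B = "lie_bracket A \<xi> E\<^sub>1 q"
  have B: "?B \<in> T q"
    by (rule vector_field_tangent[OF bracket_field[OF open_V xi_field E1_field] q])
  have "\<epsilon> = g q (h_tensor A \<phi> \<xi> E\<^sub>1 q) (E\<^sub>1 q)"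
    using q by (simp add: h_E1 g_scale_left)
  also have "\<dots> = (g q ?B (E\<^sub>1 q) - g q (\<phi> q ?B) (E\<^sub>1 q)) / 2"
    using q B by (simp add: h_eigen[OF open_V q E1_field phi_E1] g_scale_left g_diff_left)
  also have "\<dots> = g q ?B (E\<^sub>1 q)"
    using q B by (simp add: g_phi phi_E1)
  also have "\<dots> = g q (D \<xi> E\<^sub>1 q) (E\<^sub>1 q) - g q (D E\<^sub>1 \<xi> q) (E\<^sub>1 q)"
    using q D_tangent[OF open_V xi_field E1_field q] D_tangent[OF open_V E1_field xi_field q]
    by (simp add: bracket_eq[OF open_V xi_field E1_field q] g_diff_left)
  also have "g q (D \<xi> E\<^sub>1 q) (E\<^sub>1 q) = 0"
    using metric_const[OF xi_field E1_field E1_field, of 0] q by simp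
  finally have "g q (D E\<^sub>1 \<xi> q) (E\<^sub>1 q) = - \<epsilon>" by simp
  moreover have "g q (D E\<^sub>1 \<xi> q) (E\<^sub>2 q) = 0"
    using xi_divergence_free[OF q] D_xi_symmetric[OF E1_field E2_field q, of 0 0] by simp
  ultimately show ?thesis
    using D_expand(1)[OF E1_field q] by simp
qed

text \<open>Since \<xi> has constant length, every derivative of \<xi> is orthogonal to \<xi>; by
  symmetry the derivative along \<xi> is then orthogonal to the frame.\<close>

lemma D_xi_xi:
  assumes q: "q \<in> V" shows "D \<xi> \<xi> q = 0"
proof -
  have "g q (D Y \<xi> q) (\<xi> q) = 0" if "vector_field A V Y" for Y
    using metric_const[OF that xi_field xi_field, of 1 q] q by simp
  then have "g q (D \<xi> \<xi> q) (E\<^sub>1 q) = 0" "g q (D \<xi> \<xi> q) (E\<^sub>2 q) = 0"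
    using D_xi_symmetric[OF xi_field E1_field q, of 1 0] D_xi_symmetric[OF xi_field E2_field q, of 1 0]
      E1_field E2_field by simp_all
  then show ?thesis
    using D_expand(1)[OF xi_field q] by simp
qed

text \<open>The coefficients of the connection that are not determined by \<open>h\<close>, \<open>d\<eta> = 0\<close> and
  \<open>d\<Phi> = 0\<close> alone.\<close>

definition "b q = g q (D E\<^sub>1 E\<^sub>1 q) (E\<^sub>2 q)"
definition "c q = g q (D E\<^sub>2 \<xi> q) (E\<^sub>2 q)"
definition "d q = g q (D E\<^sub>2 E\<^sub>1 q) (E\<^sub>2 q)"
definition "m q = g q (D \<xi> E\<^sub>1 q) (E\<^sub>2 q)"

lemma coeff_smooth: "smooth_fun A V b" "smooth_fun A V c" "smooth_fun A V d" "smooth_fun A V m"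
  unfolding b_def c_def d_def m_def by (intro g_smooth D_field frame_fields)+

lemma D_E2_xi:
  assumes q: "q \<in> V" shows "D E\<^sub>2 \<xi> q = c q *\<^sub>R E\<^sub>1 q"
proof -
  have "g q (D E\<^sub>2 \<xi> q) (E\<^sub>1 q) = 0"
    using xi_divergence_free[OF q] D_xi_symmetric[OF E1_field E2_field q, of 0 0] by simp
  then show ?thesis
    using D_expand(1)[OF E2_field q] by (simp add: c_def)
qed

lemma D_frame:
  assumes q: "q \<in> V"
  shows "D \<xi> E\<^sub>1 q = m q *\<^sub>R E\<^sub>1 q" "D \<xi> E\<^sub>2 q = - m q *\<^sub>R E\<^sub>2 q"
    "D E\<^sub>1 E\<^sub>1 q = b q *\<^sub>R E\<^sub>1 q + \<epsilon> *\<^sub>R \<xi> q" "D E\<^sub>1 E\<^sub>2 q = - b q *\<^sub>R E\<^sub>2 q"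
    "D E\<^sub>2 E\<^sub>1 q = d q *\<^sub>R E\<^sub>1 q" "D E\<^sub>2 E\<^sub>2 q = - d q *\<^sub>R E\<^sub>2 q - c q *\<^sub>R \<xi> q"
proof -
  note x = D_expand(2,3)[OF xi_field q] and y = D_expand(2,3)[OF E1_field q]
    and z = D_expand(2,3)[OF E2_field q]
  have "g q (D \<xi> \<xi> q) u = 0" if "u \<in> T q" for u
    using that q by (simp add: D_xi_xi g_zero)
  then show "D \<xi> E\<^sub>1 q = m q *\<^sub>R E\<^sub>1 q" "D \<xi> E\<^sub>2 q = - m q *\<^sub>R E\<^sub>2 q"
    using x q by (simp_all add: m_def)
  have "g q (D E\<^sub>1 \<xi> q) (E\<^sub>1 q) = - \<epsilon>" "g q (D E\<^sub>1 \<xi> q) (E\<^sub>2 q) = 0"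
    using q g_scale_left[of _ q "E\<^sub>2 q" "- \<epsilon>"] by (simp_all add: D_E1_xi del: scaleR_minus_left)
  then show "D E\<^sub>1 E\<^sub>1 q = b q *\<^sub>R E\<^sub>1 q + \<epsilon> *\<^sub>R \<xi> q" "D E\<^sub>1 E\<^sub>2 q = - b q *\<^sub>R E\<^sub>2 q"
    using y by (simp_all add: b_def add.commute)
  have "g q (D E\<^sub>2 \<xi> q) (E\<^sub>1 q) = 0"
    using q by (simp add: D_E2_xi g_scale_left)
  then show "D E\<^sub>2 E\<^sub>1 q = d q *\<^sub>R E\<^sub>1 q" "D E\<^sub>2 E\<^sub>2 q = - d q *\<^sub>R E\<^sub>2 q - c q *\<^sub>R \<xi> q"
    using z by (simp_all add: d_def c_def)
qed

section \<open>Curvature identities for \<xi> in the frame\<close>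

lemma D_combination_left:
  assumes Z: "vector_field A V Z" and f: "smooth_fun A V f\<^sub>1" "smooth_fun A V f\<^sub>2"
    and X: "vector_field A V X" "\<And>x. x \<in> V \<Longrightarrow> X x = f\<^sub>1 x *\<^sub>R E\<^sub>1 x + f\<^sub>2 x *\<^sub>R E\<^sub>2 x" and q: "q \<in> V"
  shows "D X Z q = f\<^sub>1 q *\<^sub>R D E\<^sub>1 Z q + f\<^sub>2 q *\<^sub>R D E\<^sub>2 Z q"
proof -
  note F1 = vector_field_fmult[OF E1_field f(1)] and F2 = vector_field_fmult[OF E2_field f(2)]
  have "D X Z q = D (fmult f\<^sub>1 E\<^sub>1 + fmult f\<^sub>2 E\<^sub>2) Z q"
    by (rule D_cong[OF open_V q X(1) Z]) (simp_all add: X(2) fmult_def)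
  then show ?thesis
    using D_add_left[OF open_V F1 F2 Z q] D_fmult_left[OF open_V E1_field Z f(1) q]
      D_fmult_left[OF open_V E2_field Z f(2) q] by simp
qed

text \<open>Serves for iterated derivatives whose inner field is a constant multiple of a frame
  field on \<open>V\<close>; constancy avoids any derivative of the factor.\<close>

lemma D_multiple_right:
  assumes X: "vector_field A V X" and Y: "vector_field A V Y" and Z: "vector_field A V Z"
    and eq: "\<And>x. x \<in> V \<Longrightarrow> Y x = a *\<^sub>R Z x" and q: "q \<in> V"
  shows "D X Y q = a *\<^sub>R D X Z q"
proof -
  have "D X Y q = D X (fmult (\<lambda>_. a) Z) q"
    by (rule D_cong[OF open_V q X Y]) (simp_all add: eq fmult_def)
  then show ?thesis
    using D_scale_right[OF open_V X Z q] by simp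
qed

lemma curvature_xi:
  assumes "vector_field A V X" "vector_field A V Y" "q \<in> V"
  shows "curvature A D X Y \<xi> q =
    \<kappa> *\<^sub>R (\<eta> q (Y q) *\<^sub>R X q - \<eta> q (X q) *\<^sub>R Y q) +
    \<mu> *\<^sub>R (\<eta> q (Y q) *\<^sub>R h_tensor A \<phi> \<xi> X q - \<eta> q (X q) *\<^sub>R h_tensor A \<phi> \<xi> Y q)"
  using kappa_mu assms open_V unfolding kappa_mu_space_def by blast

text \<open>Comparing coefficients in \<open>R(E\<^sub>1, \<xi>)\<xi> = \<kappa> E\<^sub>1 + \<mu> h E\<^sub>1\<close>.\<close>

lemma c_m_eq:
  assumes q: "q \<in> V" shows "c q = \<epsilon> * \<kappa>" "m q = - (\<mu> / 2)"
proof -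
  \<comment> \<open>The inner field vanishes on \<open>V\<close>; it is written as 0 times \<xi> to
    fit the rule for constant multiples.\<close>
  have 1: "D E\<^sub>1 (D \<xi> \<xi>) q = 0 *\<^sub>R D E\<^sub>1 \<xi> q"
    by (rule D_multiple_right) (intro frame_fields D_field | simp add: D_xi_xi q)+
  have 2: "D \<xi> (D E\<^sub>1 \<xi>) q = - \<epsilon> *\<^sub>R D \<xi> E\<^sub>2 q"
    by (rule D_multiple_right) (intro frame_fields D_field | simp add: D_E1_xi q)+
  have 3: "D (lie_bracket A E\<^sub>1 \<xi>) \<xi> q = - m q *\<^sub>R D E\<^sub>1 \<xi> q + - \<epsilon> *\<^sub>R D E\<^sub>2 \<xi> q"
  proof (rule D_combination_left)
    have "smooth_fun A V (\<lambda>q. -1 * m q)"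
      by (intro smooth_fun_mult smooth_fun_const coeff_smooth open_V)
    then show "smooth_fun A V (\<lambda>q. - m q)" by simp
  qed (intro frame_fields bracket_field smooth_fun_const
      | simp add: bracket_eq[OF open_V] frame_fields D_E1_xi D_frame q fun_eq_iff scaleR_fun_def)+
  have "curvature A D E\<^sub>1 \<xi> \<xi> q = \<kappa> *\<^sub>R E\<^sub>1 q + (\<mu> * \<epsilon>) *\<^sub>R E\<^sub>2 q"
    using q by (simp add: curvature_xi E1_field xi_field h_E1)
  \<comment> \<open>The second derivative and the bracket contribute
    \<open>- \<epsilon> * m q\<close> each to the \<open>E\<^sub>2\<close> coefficient;
    \<open>\<epsilon> * c q\<close> comes from the bracket alone.\<close>
  moreover have "curvature A D E\<^sub>1 \<xi> \<xi> q = (\<epsilon> * c q) *\<^sub>R E\<^sub>1 q + (- 2 * \<epsilon> * m q) *\<^sub>R E\<^sub>2 q"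
    using q by (simp add: curvature_def 1 2 3 D_frame D_E1_xi D_E2_xi
        fun_eq_iff scaleR_fun_def algebra_simps)
  ultimately have "\<epsilon> * c q = \<kappa>" "- 2 * \<epsilon> * m q = \<mu> * \<epsilon>"
    using frame_coeff[OF q] by metis+
  moreover have "\<epsilon> = 1 \<or> \<epsilon> = - 1"
    using eps_square by (simp add: square_eq_1_iff)
  ultimately show "c q = \<epsilon> * \<kappa>" "m q = - (\<mu> / 2)"
    by auto
qed

text \<open>Comparing coefficients in \<open>R(E\<^sub>1, E\<^sub>2)\<xi> = 0\<close>.\<close>

lemma b_d_eq:
  assumes q: "q \<in> V" shows "\<kappa> * b q = 0" "d q = 0"
proof -
  \<comment> \<open>The preceding identity makes \<open>c\<close> the constant
    \<open>\<epsilon> * \<kappa>\<close> on \<open>V\<close>, so no derivative of \<open>c\<close>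
    appears.\<close>
  have 1: "D E\<^sub>1 (D E\<^sub>2 \<xi>) q = (\<epsilon> * \<kappa>) *\<^sub>R D E\<^sub>1 E\<^sub>1 q"
    by (rule D_multiple_right) (intro frame_fields D_field | simp add: D_E2_xi c_m_eq q)+
  have 2: "D E\<^sub>2 (D E\<^sub>1 \<xi>) q = - \<epsilon> *\<^sub>R D E\<^sub>2 E\<^sub>2 q"
    by (rule D_multiple_right) (intro frame_fields D_field | simp add: D_E1_xi q)+
  have 3: "D (lie_bracket A E\<^sub>1 E\<^sub>2) \<xi> q = - d q *\<^sub>R D E\<^sub>1 \<xi> q + - b q *\<^sub>R D E\<^sub>2 \<xi> q"
  proof (rule D_combination_left)
    have "smooth_fun A V (\<lambda>q. -1 * d q)" "smooth_fun A V (\<lambda>q. -1 * b q)"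
      by (intro smooth_fun_mult smooth_fun_const coeff_smooth open_V)+
    then show "smooth_fun A V (\<lambda>q. - d q)" "smooth_fun A V (\<lambda>q. - b q)" by simp_all
  qed (intro frame_fields bracket_field
      | simp add: bracket_eq[OF open_V] frame_fields D_frame q fun_eq_iff scaleR_fun_def)+
  have "curvature A D E\<^sub>1 E\<^sub>2 \<xi> q = 0 *\<^sub>R E\<^sub>1 q + 0 *\<^sub>R E\<^sub>2 q"
    using q by (simp add: curvature_xi E1_field E2_field)
  \<comment> \<open>The \<xi>-components of the two second derivatives cancel, again because
    \<open>c\<close> is \<open>\<epsilon> * \<kappa>\<close>.\<close>
  moreover have "curvature A D E\<^sub>1 E\<^sub>2 \<xi> q = (2 * \<epsilon> * \<kappa> * b q) *\<^sub>R E\<^sub>1 q + (- 2 * \<epsilon> * d q) *\<^sub>R E\<^sub>2 q"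
    using q by (simp add: curvature_def 1 2 3 D_frame D_E1_xi D_E2_xi c_m_eq
        fun_eq_iff scaleR_fun_def algebra_simps)
  ultimately have "2 * \<epsilon> * \<kappa> * b q = 0" "- 2 * \<epsilon> * d q = 0"
    using frame_coeff[OF q] by metis+
  moreover have "\<epsilon> \<noteq> 0"
    using eps_square by auto
  ultimately show "\<kappa> * b q = 0" "d q = 0"
    by simp_all
qed

end

section \<open>Rescaling an eigenfield to the adapted frame\<close>

theorem proposition10:
  fixes A :: "'m::{t2_space, second_countable_topology} chart set"
    and \<phi> :: "'m \<Rightarrow> 'm tangent \<Rightarrow> 'm tangent"
    and \<xi> :: "'m field"
    and \<eta> :: "'m \<Rightarrow> 'm tangent \<Rightarrow> real"
    and g :: "'m \<Rightarrow> 'm tangent \<Rightarrow> 'm tangent \<Rightarrow> real"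
    and D :: "'m field \<Rightarrow> 'm field \<Rightarrow> 'm field"
    and \<kappa> \<mu> :: real and p :: 'm and U :: "'m set" and X :: "'m field"
  assumes "manifold3 A"
    and "almost_paracosymplectic A \<phi> \<xi> \<eta> g"
    and "\<not> paracosymplectic A \<phi> \<xi> \<eta> g"
    and "levi_civita A g D"
    and "kappa_mu_space A \<phi> \<xi> \<eta> D \<kappa> \<mu>"
    and "open U" and "p \<in> U" and "vector_field A U X"
    and "\<forall>q\<in>U. \<phi> q (X q) = X q"
    and "\<forall>q\<in>U. h_tensor A \<phi> \<xi> X q \<noteq> 0"
  shows "\<exists>V E\<^sub>1 E\<^sub>2 (b :: 'm \<Rightarrow> real) (\<epsilon> :: real).
    open V \<and> p \<in> V \<and> artin_frame A \<phi> \<xi> g V E\<^sub>1 E\<^sub>2 \<and>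
    smooth_fun A V b \<and> (\<epsilon> = 1 \<or> \<epsilon> = -1) \<and>
    (\<forall>q\<in>V.
       D \<xi> \<xi> q = 0 \<and>
       D \<xi> E\<^sub>1 q = - (\<mu> / 2) *\<^sub>R E\<^sub>1 q \<and>
       D \<xi> E\<^sub>2 q = (\<mu> / 2) *\<^sub>R E\<^sub>2 q \<and>
       D E\<^sub>1 \<xi> q = - \<epsilon> *\<^sub>R E\<^sub>2 q \<and>
       D E\<^sub>1 E\<^sub>1 q = b q *\<^sub>R E\<^sub>1 q + \<epsilon> *\<^sub>R \<xi> q \<and>
       D E\<^sub>1 E\<^sub>2 q = - b q *\<^sub>R E\<^sub>2 q \<and>
       D E\<^sub>2 \<xi> q = (\<epsilon> * \<kappa>) *\<^sub>R E\<^sub>1 q \<and>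
       D E\<^sub>2 E\<^sub>1 q = 0 \<and>
       D E\<^sub>2 E\<^sub>2 q = - (\<epsilon> * \<kappa>) *\<^sub>R \<xi> q) \<and>
    (\<kappa> \<noteq> 0 \<longrightarrow> (\<forall>q\<in>V. b q = 0))"
proof -
  interpret paracosymplectic3 A \<phi> \<xi> \<eta> g D
    by unfold_locales (use assms in \<open>auto simp: almost_paracosymplectic_def\<close>)
  note U = \<open>open U\<close> and X = \<open>vector_field A U X\<close>
  have e: "\<phi> q (X q) = X q" if "q \<in> U" for q
    using assms that by blast
  let ?W = "h_tensor A \<phi> \<xi> X"
  note W = h_field[OF U X]
  define a where "a = (\<lambda>q. g q (X q) (?W q))"
  have a: "smooth_fun A U a"
    unfolding a_def by (rule g_smooth[OF U X W])
  have "a p \<noteq> 0"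
    unfolding a_def using g_h_nonzero[OF U \<open>p \<in> U\<close> X e] assms by blast
  define \<epsilon> where "\<epsilon> = sgn (a p)"
  have \<epsilon>: "\<epsilon> = 1 \<or> \<epsilon> = -1"
    unfolding \<epsilon>_def using \<open>a p \<noteq> 0\<close> by (auto simp: sgn_if)
  then have \<epsilon>2: "\<epsilon> * \<epsilon> = 1" by auto
  have ea: "smooth_fun A U (\<lambda>q. \<epsilon> * a q)"
    by (intro smooth_fun_mult smooth_fun_const U a)
  \<comment> \<open>On this set \<open>a\<close> keeps the sign it has at \<open>p\<close>, so
    \<open>\<epsilon> * a q\<close> is the absolute value of \<open>a q\<close>.\<close>
  define V where "V = {q \<in> U. \<epsilon> * a q > 0}"
  have V: "open V" "p \<in> V" "V \<subseteq> U"
    using smooth_fun_open_pos[OF U ea] \<open>p \<in> U\<close> \<open>a p \<noteq> 0\<close>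
    by (auto simp: V_def \<epsilon>_def sgn_mult_self_eq abs_sgn[symmetric] sgn_if zero_less_mult_iff)
  define s where "s = (\<lambda>q. (\<epsilon> * a q) powr (- 1/2))"
  have s: "smooth_fun A V s"
    unfolding s_def using smooth_fun_subset[OF ea V(3)] V(1)
    by (intro smooth_fun_powr) (auto simp: V_def)
  have ss: "s q * s q * (\<epsilon> * a q) = 1" if "q \<in> V" for q
  proof -
    have "\<epsilon> * a q > 0"
      using that by (simp add: V_def)
    then show ?thesis
      by (auto simp: s_def powr_minus_divide simp flip: powr_add)
  qed
  have es: "smooth_fun A V (\<lambda>q. \<epsilon> * s q)"
    by (intro smooth_fun_mult smooth_fun_const V s)
  note XV = vector_field_subset[OF X V(3)] and WV = vector_field_subset[OF W V(3)]
  \<comment> \<open>The factor \<open>\<epsilon>\<close> in the second field makes the inner product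
    \<open>s q * s q * (\<epsilon> * a q) = 1\<close>. It also gives
    \<open>h E\<^sub>1 = \<epsilon> E\<^sub>2\<close>, because \<open>\<epsilon>\<close> squares to
    1.\<close>
  let ?E1 = "fmult s X" and ?E2 = "fmult (\<lambda>q. \<epsilon> * s q) ?W"
  interpret h_frame A \<phi> \<xi> \<eta> g D \<kappa> \<mu> \<epsilon> V ?E1 ?E2
  proof
    show "vector_field A V ?E1" "vector_field A V ?E2"
      by (rule vector_field_fmult XV WV s es)+
    fix q assume q: "q \<in> V"
    have t: "X q \<in> T q" "?W q \<in> T q"
      using XV WV q by auto
    have qU: "q \<in> U" using q V by blast
    show "\<phi> q (?E1 q) = ?E1 q"
      using t e[OF qU] by (simp add: fmult_def phi_scale)
    show "\<phi> q (?E2 q) = - ?E2 q"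
      using t phi_h(2)[OF U qU X e] by (simp add: fmult_def phi_scale)
    show "g q (?E1 q) (?E2 q) = 1"
      using t ss[OF q] by (simp add: fmult_def g_scale_left g_scale_right a_def algebra_simps)
    show "h_tensor A \<phi> \<xi> ?E1 q = \<epsilon> *\<^sub>R ?E2 q"
      using h_fmult[OF V(1) q XV s] \<epsilon>2 by (simp add: fmult_def mult.assoc[symmetric])
  qed (use assms V \<epsilon>2 in auto)
  show ?thesis
  proof (intro exI conjI)
    show "\<forall>q\<in>V. D \<xi> \<xi> q = 0 \<and>
       D \<xi> ?E1 q = - (\<mu> / 2) *\<^sub>R ?E1 q \<and>
       D \<xi> ?E2 q = (\<mu> / 2) *\<^sub>R ?E2 q \<and>
       D ?E1 \<xi> q = - \<epsilon> *\<^sub>R ?E2 q \<and>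
       D ?E1 ?E1 q = b q *\<^sub>R ?E1 q + \<epsilon> *\<^sub>R \<xi> q \<and>
       D ?E1 ?E2 q = - b q *\<^sub>R ?E2 q \<and>
       D ?E2 \<xi> q = (\<epsilon> * \<kappa>) *\<^sub>R ?E1 q \<and>
       D ?E2 ?E1 q = 0 \<and>
       D ?E2 ?E2 q = - (\<epsilon> * \<kappa>) *\<^sub>R \<xi> q"
      by (simp add: D_xi_xi D_frame D_E1_xi D_E2_xi c_m_eq b_d_eq)
    show "\<kappa> \<noteq> 0 \<longrightarrow> (\<forall>q\<in>V. b q = 0)"
      using b_d_eq by auto
  qed (use V \<epsilon> artin coeff_smooth in auto)
qed

end
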